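(* Let $X$ be a hyperbolic Riemann surface, let $\{f_n\}_{n\ge1}$ be a sequence of nonconstant maps in $\mathrm{Hol}(X,X)$, and let $L_n=f_n\circ f_{n-1}\circ\dots\circ f_1$. Suppose that $\{L_n\}$ is relatively compact in $\mathrm{Hol}(X,X)$. Then the following statements are equivalent. (i) All limit points of $\{L_n\}$ in $\mathrm{Hol}(X,X)$ are nonconstant. (ii) The sequence $\{L_n\}$ has a nonconstant limit point in $\mathrm{Hol}(X,X)$. (iii) There exists $z_0\in X$ with $\sum_n\bigl(1-f_n^\#(z_0)\bigr)<+\infty$. (iv) For all $z\in X$ we have $\sum_n\bigl(1-f_n^\#(z)\bigr)<+\infty$.
   Context: For a hyperbolic Riemann surface $X$, $\omega_X$ denotes its hyperbolic distance, and $\mathrm{Hol}(X,X)$ is the space of holomorphic self-maps of $X$ with the compact-open topology (convergence is uniform convergence on compact subsets of $X$, with limit a self-map of $X$). A sequence is relatively compact in $\mathrm{Hol}(X,X)$ if its closure there is compact; a limit point of a sequence is a limit of some subsequence. The hyperbolic distortion of $f\in\mathrm{Hol}(X,X)$ is $f^\#(z)=\lim_{w\to z}\omega_X(f(z),f(w))/\omega_X(z,w)$; one has $0\le f^\#\le 1$. *)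

theory Defs
  imports "HOL-Analysis.Analysis"
begin

text \<open>
  A Riemann surface is a connected subset \<open>X\<close> of a Hausdorff space, with the subspace topology,
  together with a holomorphic atlas \<open>A\<close> of charts \<open>(U, \<phi>)\<close>. Taking \<open>X = UNIV\<close> covers surfaces
  that are whole types. Second countability is not assumed; it is automatic
  for connected surfaces by Rado's theorem. The atlas need not be maximal.
\<close>

type_synonym 'a chart = "'a set \<times> ('a \<Rightarrow> complex)"

definition riemann_surface :: "'a::t2_space set \<Rightarrow> 'a chart set \<Rightarrow> bool" where
  "riemann_surface X A \<longleftrightarrow>
     X \<noteq> {} \<and> connected X \<and>
     (\<Union>(U, \<phi>)\<in>A. U) = X \<and>
     (\<forall>(U, \<phi>)\<in>A. openin (top_of_set X) U \<and> open (\<phi> ` U) \<and>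
        homeomorphism U (\<phi> ` U) \<phi> (the_inv_into U \<phi>)) \<and>
     (\<forall>(U, \<phi>)\<in>A. \<forall>(V, \<psi>)\<in>A. (\<psi> \<circ> the_inv_into U \<phi>) holomorphic_on \<phi> ` (U \<inter> V))"

definition holomorphic_map ::
  "'a::t2_space set \<Rightarrow> 'a chart set \<Rightarrow> 'b::t2_space set \<Rightarrow> 'b chart set \<Rightarrow> ('a \<Rightarrow> 'b) \<Rightarrow> bool" where
  "holomorphic_map X A Y B f \<longleftrightarrow>
     f \<in> X \<rightarrow> Y \<and> continuous_on X f \<and>
     (\<forall>(U, \<phi>)\<in>A. \<forall>(V, \<psi>)\<in>B.
        (\<psi> \<circ> f \<circ> the_inv_into U \<phi>) holomorphic_on \<phi> ` (U \<inter> f -` V))"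

text \<open>
  Maps are extensional (\<open>undefined\<close> off \<open>X\<close>), so that elements of \<open>Hol\<close> are exactly the
  holomorphic maps from \<open>X\<close> to \<open>Y\<close>.
\<close>

definition Hol ::
  "'a::t2_space set \<Rightarrow> 'a chart set \<Rightarrow> 'b::t2_space set \<Rightarrow> 'b chart set \<Rightarrow> ('a \<Rightarrow> 'b) set" where
  "Hol X A Y B = {f \<in> X \<rightarrow>\<^sub>E Y. holomorphic_map X A Y B f}"

definition compact_open_topology ::
  "'a::t2_space set \<Rightarrow> 'b::t2_space set \<Rightarrow> ('a \<Rightarrow> 'b) set \<Rightarrow> ('a \<Rightarrow> 'b) topology" where
  "compact_open_topology X Y F =
     topology_generated_by
       {{f \<in> F. f ` K \<subseteq> U} | K U. compact K \<and> K \<subseteq> X \<and> openin (top_of_set Y) U}"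

abbreviation Hol_topology :: "'a::t2_space set \<Rightarrow> 'a chart set \<Rightarrow> ('a \<Rightarrow> 'a) topology" where
  "Hol_topology X A \<equiv> compact_open_topology X X (Hol X A X A)"

definition relatively_compactin :: "'a topology \<Rightarrow> 'a set \<Rightarrow> bool" where
  "relatively_compactin T S \<longleftrightarrow> S \<subseteq> topspace T \<and> compactin T (T closure_of S)"

definition seq_limit_point :: "'a topology \<Rightarrow> (nat \<Rightarrow> 'a) \<Rightarrow> 'a \<Rightarrow> bool" where
  "seq_limit_point T s g \<longleftrightarrow> (\<exists>r::nat \<Rightarrow> nat. strict_mono r \<and> limitin T (s \<circ> r) g sequentially)"

abbreviation unit_disc :: "complex set" where
  "unit_disc \<equiv> ball 0 1"

definition disc_atlas :: "complex chart set" where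
  "disc_atlas = {(unit_disc, id)}"

text \<open>
  The disc is simply connected, so a holomorphic covering by the disc is a universal covering.
\<close>

definition disc_covering :: "'a::t2_space set \<Rightarrow> 'a chart set \<Rightarrow> (complex \<Rightarrow> 'a) \<Rightarrow> bool" where
  "disc_covering X A p \<longleftrightarrow>
     covering_space unit_disc p X \<and> holomorphic_map unit_disc disc_atlas X A p"

definition hyperbolic_surface :: "'a::t2_space set \<Rightarrow> 'a chart set \<Rightarrow> bool" where
  "hyperbolic_surface X A \<longleftrightarrow> riemann_surface X A \<and> (\<exists>p. disc_covering X A p)"

text \<open>
  The normalization is that of the metric \<open>\<bar>dz\<bar> / (1 - \<bar>z\<bar>\<^sup>2)\<close> (curvature \<open>-4\<close>); the curvature \<open>-1\<close>
  convention doubles all distances, which does not affect the hyperbolic distortion below.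
\<close>

definition disc_dist :: "complex \<Rightarrow> complex \<Rightarrow> real" where
  "disc_dist a b = artanh (cmod ((a - b) / (1 - cnj b * a)))"

text \<open>
  The hyperbolic distance is the quotient of that of the disc under a universal covering. Two
  universal coverings differ by an automorphism of the disc, which is an isometry, so the choice
  of covering is immaterial.
\<close>

definition hyp_dist :: "'a::t2_space set \<Rightarrow> 'a chart set \<Rightarrow> 'a \<Rightarrow> 'a \<Rightarrow> real" where
  "hyp_dist X A z w =
     (let p = (SOME p. disc_covering X A p)
      in Inf {disc_dist a b | a b. a \<in> unit_disc \<and> b \<in> unit_disc \<and> p a = z \<and> p b = w})"

definition hyp_distortion :: "'a::t2_space set \<Rightarrow> 'a chart set \<Rightarrow> ('a \<Rightarrow> 'a) \<Rightarrow> 'a \<Rightarrow> real" where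
  "hyp_distortion X A f z =
     Lim (at z within X) (\<lambda>w. hyp_dist X A (f z) (f w) / hyp_dist X A z w)"

text \<open>
  \<open>left_comp X f n\<close> is \<open>f n \<circ> \<dots> \<circ> f 1\<close> on \<open>X\<close>; the value \<open>f 0\<close> is never used.
\<close>

primrec left_comp :: "'a set \<Rightarrow> (nat \<Rightarrow> 'a \<Rightarrow> 'a) \<Rightarrow> nat \<Rightarrow> ('a \<Rightarrow> 'a)" where
  "left_comp X f 0 = (\<lambda>x\<in>X. x)"
| "left_comp X f (Suc n) = compose X (f (Suc n)) (left_comp X f n)"

end

theory Submission
  imports Defs "HOL-Complex_Analysis.Complex_Analysis"
begin

text \<open>
  Everything is transported to the unit disc by a holomorphic covering \<open>p\<close>. A holomorphic
  self-map \<open>f\<close> of \<open>X\<close> lifts to a holomorphic self-map \<open>F\<close> of the disc with \<open>p \<circ> F = f \<circ> p\<close>.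
  The covering is locally isometric, because any point of a fibre is carried to any other by a
  lift of \<open>p\<close> through itself, which does not increase distances by the Schwarz--Pick lemma. Hence the hyperbolic
  distortion of \<open>f\<close> at \<open>p a\<close> is the classical invariant derivative
  \<open>(1 - \<bar>a\<bar>\<^sup>2) \<bar>F' a\<bar> / (1 - \<bar>F a\<bar>\<^sup>2)\<close> (\<open>hyp_distortion_eq_disc_distortion\<close>).
  Existence of lifts is \<open>covering_space_lift_convex\<close>.

  The distortion is multiplicative: at \<open>x = p a\<close> the distortion of \<open>L n\<close> is the product of the
  factors \<open>f\<^sub>k\<^sup>#(L\<^sub>k\<^sub>-\<^sub>1 x)\<close> with \<open>k \<le> n\<close>. These lie in \<open>[0,1]\<close>, so the product decreases, and if no
  factor vanishes its limit is positive exactly when the sum of the \<open>1 - f\<^sub>k\<^sup>#(L\<^sub>k\<^sub>-\<^sub>1 x)\<close> is finite.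
  The moving points \<open>L\<^sub>k\<^sub>-\<^sub>1 x\<close> can be traded for one fixed point: the orbit of \<open>x\<close> is
  relatively compact, and for every self-map of the disc the quantities \<open>1 - F\<^sup>#(a)\<close>
  and \<open>1 - F\<^sup>#(b)\<close> are comparable, with constants depending only on the
  distance of \<open>a\<close> and \<open>b\<close> (\<open>disc_distortion_compare\<close>). This makes summability
  independent of the point and equivalent to summability along orbits (\<open>summable_along_orbit_iff\<close>).

  Finally, by Montel's theorem suitable lifts of a convergent subsequence of the \<open>L n\<close> converge, to
  a lift \<open>G\<close> of the limit, so that the distortion of \<open>G\<close> at \<open>a\<close> is the limit of the products
  (\<open>limit_point_lift\<close>). A nonconstant limit has \<open>G' a \<noteq> 0\<close> for some \<open>a\<close>, whence the product at \<open>a\<close>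
  stays away from zero and the sum is finite. Conversely, if the sum is finite, take \<open>a\<close> outside
  the countable set of critical points of all composites: there the product has a positive limit,
  so \<open>G' a \<noteq> 0\<close> for every limit point. Limit points exist, by the same Montel argument
  applied to an orbit (\<open>limit_point_exists\<close>).
\<close>

section \<open>Holomorphic self-maps of the disc\<close>

abbreviation mob :: "complex \<Rightarrow> complex \<Rightarrow> complex" where
  "mob \<equiv> Moebius_function 0"

definition disc_map :: "(complex \<Rightarrow> complex) \<Rightarrow> bool" where
  "disc_map F \<longleftrightarrow> F holomorphic_on unit_disc \<and> F \<in> unit_disc \<rightarrow> unit_disc"

text \<open>
  The hyperbolic distortion of a self-map of the disc in closed form.
\<close>

definition disc_distortion :: "(complex \<Rightarrow> complex) \<Rightarrow> complex \<Rightarrow> real" where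
  "disc_distortion F z = (1 - (cmod z)\<^sup>2) * cmod (deriv F z) / (1 - (cmod (F z))\<^sup>2)"

lemma disc_map_in: "disc_map F \<Longrightarrow> cmod z < 1 \<Longrightarrow> cmod (F z) < 1"
  by (auto simp: disc_map_def Pi_iff)

lemma disc_map_deriv:
  "disc_map F \<Longrightarrow> cmod z < 1 \<Longrightarrow> (F has_field_derivative deriv F z) (at z)"
  by (auto simp: disc_map_def intro!: holomorphic_derivI[of F unit_disc])

lemma disc_map_compose: "disc_map F \<Longrightarrow> disc_map G \<Longrightarrow> disc_map (G \<circ> F)"
  by (auto simp: disc_map_def Pi_iff intro!: holomorphic_on_compose_gen[of F unit_disc G unit_disc])

lemma disc_map_mob: "cmod a < 1 \<Longrightarrow> disc_map (mob a)"
  by (auto simp: disc_map_def Moebius_function_holomorphic Moebius_function_norm_lt_1)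

lemma mob_denominator_nonzero:
  assumes "cmod a < 1" "cmod z < 1" shows "1 - cnj a * z \<noteq> 0"
proof
  assume "1 - cnj a * z = 0"
  then have "cnj a * z = 1" by simp
  then have "cmod a * cmod z = 1" by (metis complex_mod_cnj norm_mult norm_one)
  moreover have "cmod a * cmod z < 1"
    using assms mult_strict_mono[of "cmod a" 1 "cmod z" 1] by simp
  ultimately show False by simp
qed

lemma cmod_square_less_1: "cmod a < 1 \<Longrightarrow> (cmod a)\<^sup>2 < 1"
  by (simp add: abs_square_less_1)

lemma mob_uminus_mob: "cmod a < 1 \<Longrightarrow> cmod z < 1 \<Longrightarrow> mob (- a) (mob a z) = z"
  by (rule Moebius_function_compose) auto

lemma cmod_mob_commute: "cmod (mob a b) = cmod (mob b a)"
proof -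
  have "cmod (1 - cnj a * b) = cmod (cnj (1 - cnj a * b))" by (simp only: complex_mod_cnj)
  also have "\<dots> = cmod (1 - cnj b * a)" by (simp add: mult.commute)
  finally show ?thesis
    by (simp add: Moebius_function_simple norm_divide norm_minus_commute)
qed

lemma one_minus_cmod_mob_square:
  assumes "cmod a < 1" "cmod z < 1"
  shows "1 - (cmod (mob a z))\<^sup>2 = (1 - (cmod a)\<^sup>2) * (1 - (cmod z)\<^sup>2) / (cmod (1 - cnj a * z))\<^sup>2"
proof -
  have nz: "cmod (1 - cnj a * z) \<noteq> 0" using mob_denominator_nonzero[OF assms] by simp
  have "(cmod (1 - cnj a * z))\<^sup>2 - (cmod (z - a))\<^sup>2 = (1 - (cmod a)\<^sup>2) * (1 - (cmod z)\<^sup>2)"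
    unfolding cmod_power2 by (simp add: algebra_simps power2_eq_square)
  then show ?thesis using nz
    by (simp add: Moebius_function_simple norm_divide power_divide diff_divide_eq_iff)
qed

lemma deriv_mob:
  assumes "cmod a < 1" "cmod z < 1"
  shows "deriv (mob a) z = (1 - (cmod a)\<^sup>2) / (1 - cnj a * z)\<^sup>2"
proof -
  have nz: "1 - cnj a * z \<noteq> 0" using mob_denominator_nonzero[OF assms] .
  have cc: "of_real ((cmod a)\<^sup>2) = a * cnj a" by (simp add: complex_norm_square del: of_real_power)
  have "((\<lambda>z. (z - a) / (1 - cnj a * z)) has_field_derivative
      ((1 - cnj a * z) + (z - a) * cnj a) / ((1 - cnj a * z) * (1 - cnj a * z))) (at z)"
    using nz by (auto intro!: derivative_eq_intros)
  then have "(mob a has_field_derivative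
      ((1 - cnj a * z) + (z - a) * cnj a) / ((1 - cnj a * z) * (1 - cnj a * z))) (at z)"
    by (simp add: Moebius_function_simple[abs_def])
  moreover have "(1 - cnj a * z) + (z - a) * cnj a = 1 - of_real ((cmod a)\<^sup>2)"
    unfolding cc by (simp add: algebra_simps)
  ultimately show ?thesis by (simp add: DERIV_imp_deriv power2_eq_square)
qed

lemma disc_distortion_mob:
  assumes "cmod a < 1" "cmod z < 1"
  shows "disc_distortion (mob a) z = 1"
proof -
  have "cmod (1 - complex_of_real ((cmod a)\<^sup>2)) = cmod (complex_of_real (1 - (cmod a)\<^sup>2))"
    by simp
  also have "\<dots> = 1 - (cmod a)\<^sup>2"
    using cmod_square_less_1[OF assms(1)] by (simp only: norm_of_real)
  finally have *: "cmod (1 - complex_of_real ((cmod a)\<^sup>2)) = 1 - (cmod a)\<^sup>2" .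
  have "cmod (1 - cnj a * z) \<noteq> 0" using mob_denominator_nonzero[OF assms] by simp
  moreover have "1 - (cmod a)\<^sup>2 \<noteq> 0" "1 - (cmod z)\<^sup>2 \<noteq> 0"
    using cmod_square_less_1 assms by fastforce+
  moreover have "cmod (deriv (mob a) z) = (1 - (cmod a)\<^sup>2) / (cmod (1 - cnj a * z))\<^sup>2"
    unfolding deriv_mob[OF assms] norm_divide norm_power using * by simp
  ultimately show ?thesis
    unfolding disc_distortion_def one_minus_cmod_mob_square[OF assms] by simp
qed

lemma disc_distortion_nonneg: "disc_map F \<Longrightarrow> cmod z < 1 \<Longrightarrow> 0 \<le> disc_distortion F z"
  using cmod_square_less_1[of z] cmod_square_less_1[of "F z"] disc_map_in[of F z]
  by (auto simp: disc_distortion_def)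

lemma disc_distortion_eq_0_iff:
  "disc_map F \<Longrightarrow> cmod z < 1 \<Longrightarrow> disc_distortion F z = 0 \<longleftrightarrow> deriv F z = 0"
  using cmod_square_less_1[of z] cmod_square_less_1[of "F z"] disc_map_in[of F z]
  by (auto simp: disc_distortion_def)

lemma disc_distortion_compose:
  assumes "disc_map F" "disc_map G" "cmod z < 1"
  shows "disc_distortion (G \<circ> F) z = disc_distortion G (F z) * disc_distortion F z"
proof -
  have "cmod (F z) < 1" by (rule disc_map_in[OF assms(1,3)])
  then have "1 - (cmod (F z))\<^sup>2 \<noteq> 0" using cmod_square_less_1 by fastforce
  moreover have "deriv (G \<circ> F) z = deriv G (F z) * deriv F z"
    using disc_map_deriv[OF assms(1,3)] disc_map_deriv[OF assms(2) \<open>cmod (F z) < 1\<close>]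
    by (intro DERIV_imp_deriv DERIV_chain)
  ultimately show ?thesis
    by (simp add: disc_distortion_def norm_mult)
qed

text \<open>
  Since \<open>mob a\<close> has distortion \<open>1\<close> everywhere, composing with such maps on both sides moves \<open>a\<close> and
  \<open>F a\<close> to the origin without changing any distortion. This reduces two-point statements about the
  disc to the Schwarz lemma.
\<close>

lemma disc_map_normalize:
  assumes "disc_map F" "cmod a < 1"
  defines "H \<equiv> mob (F a) \<circ> (F \<circ> mob (- a))"
  shows "disc_map H" "H 0 = 0"
    "\<And>z. cmod z < 1 \<Longrightarrow> H (mob a z) = mob (F a) (F z)"
    "\<And>z. cmod z < 1 \<Longrightarrow> disc_distortion H (mob a z) = disc_distortion F z"
proof -
  have a: "cmod (- a) < 1" using assms by simp
  have Fa: "cmod (F a) < 1" using assms disc_map_in by blast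
  show "disc_map H"
    unfolding H_def using assms a Fa by (intro disc_map_compose disc_map_mob)
  show "H 0 = 0" by (simp add: H_def Moebius_function_of_zero Moebius_function_eq_zero)
  fix z :: complex assume z: "cmod z < 1"
  show "H (mob a z) = mob (F a) (F z)"
    using mob_uminus_mob[OF assms(2) z] by (simp add: H_def)
  have w: "cmod (mob a z) < 1" using assms(2) z by (rule Moebius_function_norm_lt_1)
  have "cmod (F z) < 1" using assms z disc_map_in by blast
  then show "disc_distortion H (mob a z) = disc_distortion F z"
    unfolding H_def using assms a Fa w z
    by (simp add: disc_distortion_compose disc_map_compose disc_map_mob disc_distortion_mob
        mob_uminus_mob)
qed

lemma Schwarz_Pick:
  assumes "disc_map F" "cmod a < 1" "cmod b < 1"
  shows "cmod (mob (F a) (F b)) \<le> cmod (mob a b)"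
    and "disc_distortion F a \<le> 1"
proof -
  define H where "H = mob (F a) \<circ> (F \<circ> mob (- a))"
  note H = disc_map_normalize[OF assms(1,2), folded H_def]
  have *: "H holomorphic_on unit_disc" "\<And>z. cmod z < 1 \<Longrightarrow> cmod (H z) < 1"
    using H(1) disc_map_in by (auto simp: disc_map_def)
  have "cmod (mob a b) < 1" using assms by (intro Moebius_function_norm_lt_1)
  then show "cmod (mob (F a) (F b)) \<le> cmod (mob a b)"
    using Schwarz_Lemma(1)[OF *(1) H(2) *(2)] H(3)[OF assms(3)] by fastforce
  have "disc_distortion F a = disc_distortion H 0"
    using H(4)[OF assms(2)] by (simp add: Moebius_function_eq_zero)
  also have "\<dots> = cmod (deriv H 0)" using H(2) by (simp add: disc_distortion_def)
  finally show "disc_distortion F a \<le> 1"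
    using Schwarz_Lemma(2)[OF *(1) H(2) *(2), of 0] by simp
qed

text \<open>
  Both bounds are forms of the Schwarz--Pick lemma; by the maximum principle a map into the closed
  disc is either a self-map of the open disc or constant. The second bound, an inequality of Harnack type for \<open>1 - \<bar>g\<bar>\<close>,
  follows from \<open>s - t \<le> \<rho> (1 - s t)\<close> where \<open>s = \<bar>g 0\<bar>\<close>, \<open>t = \<bar>g c\<bar>\<close>, \<open>\<rho> = \<bar>c\<bar>\<close>.
\<close>

lemma Schwarz_Pick_cball:
  assumes hol: "g holomorphic_on unit_disc"
    and le: "\<And>z. cmod z < 1 \<Longrightarrow> cmod (g z) \<le> 1" and c: "cmod c < 1"
  shows "(1 - (cmod c)\<^sup>2) * cmod (deriv g c) \<le> 1 - (cmod (g c))\<^sup>2"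
    and "1 - cmod (g c) \<le> (1 + cmod c) / (1 - cmod c) * (1 - cmod (g 0))"
proof -
  define \<rho> where "\<rho> = cmod c"
  define s where "s = cmod (g 0)"
  define t where "t = cmod (g c)"
  have \<rho>: "0 \<le> \<rho>" "\<rho> < 1" using c by (auto simp: \<rho>_def)
  have "(1 - \<rho>\<^sup>2) * cmod (deriv g c) \<le> 1 - t\<^sup>2 \<and> 1 - t \<le> (1 + \<rho>) / (1 - \<rho>) * (1 - s)"
  proof (cases "\<forall>z. cmod z < 1 \<longrightarrow> cmod (g z) < 1")
    case True
    then have dm: "disc_map g" using hol by (auto simp: disc_map_def)
    have st: "0 \<le> s" "s < 1" "0 \<le> t" "t < 1" using True c by (auto simp: s_def t_def)
    have "1 - t\<^sup>2 > 0" using cmod_square_less_1[of "g c"] st by (simp add: t_def)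
    then have 1: "(1 - \<rho>\<^sup>2) * cmod (deriv g c) \<le> 1 - t\<^sup>2"
      using Schwarz_Pick(2)[OF dm c c] by (simp add: disc_distortion_def \<rho>_def t_def)
    define N where "N = cmod (1 - cnj (g 0) * g c)"
    have "cmod (cnj (g 0) * g c) = s * t" by (simp add: norm_mult s_def t_def)
    then have N: "1 - s * t \<le> N"
      using norm_triangle_ineq2[of 1 "cnj (g 0) * g c"] by (simp add: N_def)
    have st1: "s * t < 1" using st mult_strict_mono[of s 1 t 1] by simp
    have "cmod (mob (g 0) (g c)) \<le> \<rho>"
      using Schwarz_Pick(1)[OF dm _ c, of 0] by (simp add: \<rho>_def Moebius_function_simple)
    then have "1 - \<rho>\<^sup>2 \<le> 1 - (cmod (mob (g 0) (g c)))\<^sup>2"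
      using power_mono by fastforce
    also have "\<dots> = (1 - s\<^sup>2) * (1 - t\<^sup>2) / N\<^sup>2"
      unfolding s_def t_def N_def using True c by (intro one_minus_cmod_mob_square) auto
    finally have "(1 - \<rho>\<^sup>2) * N\<^sup>2 \<le> (1 - s\<^sup>2) * (1 - t\<^sup>2)"
      using N st1 by (simp add: pos_le_divide_eq)
    moreover have "(1 - \<rho>\<^sup>2) * (1 - s * t)\<^sup>2 \<le> (1 - \<rho>\<^sup>2) * N\<^sup>2"
      using N st1 \<rho> cmod_square_less_1[OF c] by (intro mult_left_mono power_mono) (auto simp: \<rho>_def)
    ultimately have "(1 - \<rho>\<^sup>2) * (1 - s * t)\<^sup>2 \<le> (1 - s\<^sup>2) * (1 - t\<^sup>2)"
      by linarith
    then have "(s - t)\<^sup>2 \<le> (\<rho> * (1 - s * t))\<^sup>2"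
      by (simp add: power2_eq_square algebra_simps)
    then have "s - t \<le> \<rho> * (1 - s * t)"
      by (rule power2_le_imp_le) (use \<rho> st1 in simp)
    moreover have "s * (1 - t) \<le> 1 * (1 - t)" using st by (intro mult_right_mono) auto
    then have "\<rho> * (1 - s * t) \<le> \<rho> * ((1 - s) + (1 - t))"
      using \<rho> by (intro mult_left_mono) (auto simp: algebra_simps)
    ultimately have "(1 - t) * (1 - \<rho>) \<le> (1 + \<rho>) * (1 - s)"
      by (simp add: algebra_simps)
    then show ?thesis using 1 \<rho> by (simp add: pos_le_divide_eq)
  next
    case False
    then obtain z where z: "cmod z < 1" "cmod (g z) = 1" using le by force
    have "g constant_on unit_disc"
      using z le by (intro maximum_modulus_principle[OF hol, of unit_disc z]) auto
    then obtain k where k: "\<And>w. cmod w < 1 \<Longrightarrow> g w = k"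
      by (auto simp: constant_on_def)
    have "deriv g c = deriv (\<lambda>_. k) c"
      using k c by (intro complex_derivative_transform_within_open[of _ unit_disc] hol) auto
    then show ?thesis using k[OF z(1)] k[OF c] k[of 0] z(2) by (simp add: s_def t_def)
  qed
  then show "(1 - (cmod c)\<^sup>2) * cmod (deriv g c) \<le> 1 - (cmod (g c))\<^sup>2"
    and "1 - cmod (g c) \<le> (1 + cmod c) / (1 - cmod c) * (1 - cmod (g 0))"
    by (simp_all add: \<rho>_def s_def t_def)
qed

text \<open>
  Write \<open>F z = z h z\<close> with \<open>h\<close> mapping into the closed disc, so that \<open>F\<close> has distortion \<open>\<bar>h 0\<bar>\<close> at \<open>0\<close>.
  At \<open>c\<close>, the derivative \<open>h c + c h' c\<close> differs from \<open>h c\<close> by at most a multiple of \<open>1 - \<bar>h c\<bar>\<^sup>2\<close>, and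
  the previous lemma carries \<open>1 - \<bar>h c\<bar>\<close> back to \<open>1 - \<bar>h 0\<bar>\<close>.
\<close>

lemma disc_distortion_compare_0:
  assumes dm: "disc_map F" and F0: "F 0 = 0" and c: "cmod c < 1"
  shows "1 - disc_distortion F c \<le> ((1 + cmod c) / (1 - cmod c))\<^sup>2 * (1 - disc_distortion F 0)"
proof -
  have hol: "F holomorphic_on unit_disc" using dm by (simp add: disc_map_def)
  obtain h where h: "h holomorphic_on unit_disc" "\<And>z. cmod z < 1 \<Longrightarrow> F z = z * h z"
    "deriv F 0 = h 0"
    using Schwarz3[OF hol F0] by metis
  have Fle: "cmod (F z) \<le> cmod z" and d0: "cmod (deriv F 0) \<le> 1" if "cmod z < 1" for z
    using Schwarz_Lemma(1,2)[OF hol F0 _ that] dm disc_map_in by blast+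
  have hle: "cmod (h z) \<le> 1" if "cmod z < 1" for z
  proof (cases "z = 0")
    case True then show ?thesis using d0[of 0] h(3) by simp
  next
    case False then show ?thesis using Fle[OF that] h(2)[OF that] by (simp add: norm_mult)
  qed
  define \<rho> where "\<rho> = cmod c"
  define t where "t = cmod (h c)"
  note SP = Schwarz_Pick_cball[OF h(1) hle c, folded \<rho>_def t_def]
  have \<rho>: "0 \<le> \<rho>" "\<rho> < 1" using c by (auto simp: \<rho>_def)
  have t: "0 \<le> t" "t \<le> 1" using hle[OF c] by (auto simp: t_def)
  have rt: "\<rho> * t \<le> \<rho>" "0 \<le> \<rho> * t" using \<rho> t by (auto simp: mult_left_le)
  have "(h has_field_derivative deriv h c) (at c)"
    using h(1) c by (intro holomorphic_derivI[of h unit_disc]) auto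
  then have "((\<lambda>z. z * h z) has_field_derivative h c + c * deriv h c) (at c)"
    by (auto intro!: derivative_eq_intros)
  then have "(F has_field_derivative h c + c * deriv h c) (at c)"
    using h(2) c
    by (intro has_field_derivative_transform_within_open[of "\<lambda>z. z * h z" _ c unit_disc F]) auto
  then have "deriv F c = h c + c * deriv h c" by (rule DERIV_imp_deriv)
  then have "t - \<rho> * cmod (deriv h c) \<le> cmod (deriv F c)"
    using norm_diff_ineq[of "h c" "c * deriv h c"] by (simp add: norm_mult t_def \<rho>_def)
  then have "(1 - \<rho>\<^sup>2) * (t - \<rho> * cmod (deriv h c)) \<le> (1 - \<rho>\<^sup>2) * cmod (deriv F c)"
    using cmod_square_less_1[OF c] by (intro mult_left_mono) (auto simp: \<rho>_def)
  moreover have "\<rho> * ((1 - \<rho>\<^sup>2) * cmod (deriv h c)) \<le> \<rho> * (1 - t\<^sup>2)"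
    using SP(1) \<rho> by (intro mult_left_mono)
  ultimately have A: "(1 - \<rho>\<^sup>2) * t - \<rho> * (1 - t\<^sup>2) \<le> (1 - \<rho>\<^sup>2) * cmod (deriv F c)"
    by (simp add: algebra_simps)
  have pos: "1 - (\<rho> * t)\<^sup>2 > 0" using rt \<rho> by (simp add: abs_square_less_1)
  have "cmod (F c) = \<rho> * t" using h(2)[OF c] by (simp add: norm_mult t_def \<rho>_def)
  then have "1 - disc_distortion F c = (1 - (\<rho> * t)\<^sup>2 - (1 - \<rho>\<^sup>2) * cmod (deriv F c)) / (1 - (\<rho> * t)\<^sup>2)"
    using pos by (simp add: disc_distortion_def \<rho>_def diff_divide_distrib)
  also have "\<dots> \<le> ((1 - t) * (1 + \<rho>) * (1 + \<rho> * t)) / (1 - (\<rho> * t)\<^sup>2)"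
    using A pos by (intro divide_right_mono) (auto simp: algebra_simps power2_eq_square)
  also have "\<dots> = (1 - t) * (1 + \<rho>) / (1 - \<rho> * t)"
  proof -
    have "1 - (\<rho> * t)\<^sup>2 = (1 - \<rho> * t) * (1 + \<rho> * t)" by (simp add: algebra_simps power2_eq_square)
    moreover have "1 + \<rho> * t > 0" using rt by linarith
    ultimately show ?thesis by simp
  qed
  also have "\<dots> \<le> (1 - t) * (1 + \<rho>) / (1 - \<rho>)"
    using \<rho> t rt by (intro divide_left_mono mult_nonneg_nonneg mult_pos_pos) auto
  also have "\<dots> = (1 + \<rho>) / (1 - \<rho>) * (1 - t)" by simp
  also have "\<dots> \<le> (1 + \<rho>) / (1 - \<rho>) * ((1 + \<rho>) / (1 - \<rho>) * (1 - cmod (h 0)))"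
    using SP(2) \<rho> by (intro mult_left_mono) auto
  also have "cmod (h 0) = disc_distortion F 0"
    using h(3) F0 by (simp add: disc_distortion_def)
  finally show ?thesis by (simp add: \<rho>_def power2_eq_square mult.assoc)
qed

text \<open>
  The constant is \<open>exp (4 d)\<close>, where \<open>d = artanh \<bar>mob a b\<bar>\<close> is the hyperbolic distance of \<open>a\<close> and \<open>b\<close>;
  what matters is that it does not depend on \<open>F\<close>.
\<close>

lemma disc_distortion_compare:
  assumes "disc_map F" "cmod a < 1" "cmod b < 1"
  shows "1 - disc_distortion F b
    \<le> ((1 + cmod (mob a b)) / (1 - cmod (mob a b)))\<^sup>2 * (1 - disc_distortion F a)"
proof -
  define H where "H = mob (F a) \<circ> (F \<circ> mob (- a))"
  note H = disc_map_normalize[OF assms(1,2), folded H_def]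
  have "disc_distortion H 0 = disc_distortion F a"
    using H(4)[OF assms(2)] by (simp add: Moebius_function_eq_zero)
  then show ?thesis
    using disc_distortion_compare_0[OF H(1,2) Moebius_function_norm_lt_1[OF assms(2,3), of 0]]
      H(4)[OF assms(3)] by simp
qed

lemma disc_distortion_compare_uniform:
  assumes "0 \<le> \<rho>" "\<rho> < 1"
  obtains M where "0 \<le> M"
    "\<And>F a b. \<lbrakk>disc_map F; cmod a \<le> \<rho>; cmod b \<le> \<rho>\<rbrakk>
      \<Longrightarrow> 1 - disc_distortion F b \<le> M * (1 - disc_distortion F a)"
proof -
  \<comment> \<open>bounds \<open>\<bar>mob a b\<bar>\<close> by way of \<open>1 - \<bar>mob a b\<bar>\<^sup>2 \<ge> (1 - \<rho>\<^sup>2)\<^sup>2 / 4\<close>\<close>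
  define \<sigma> where "\<sigma> = sqrt (1 - (1 - \<rho>\<^sup>2)\<^sup>2 / 4)"
  have \<rho>2: "0 \<le> \<rho>\<^sup>2" "\<rho>\<^sup>2 < 1" using assms by (auto simp: power_less_one_iff abs_square_less_1)
  then have pos: "0 < (1 - \<rho>\<^sup>2)\<^sup>2" by simp
  have "(1 - \<rho>\<^sup>2)\<^sup>2 \<le> 1" using \<rho>2 by (simp add: power_le_one)
  then have \<sigma>: "0 \<le> \<sigma>" "\<sigma> < 1" using pos by (auto simp: \<sigma>_def)
  have mob_le: "cmod (mob a b) \<le> \<sigma>" if a: "cmod a \<le> \<rho>" and b: "cmod b \<le> \<rho>" for a b
  proof -
    have a1: "cmod a < 1" and b1: "cmod b < 1" using a b assms by auto
    have sq: "(cmod a)\<^sup>2 \<le> \<rho>\<^sup>2" "(cmod b)\<^sup>2 \<le> \<rho>\<^sup>2" using a b by (auto intro: power_mono)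
    define N where "N = cmod (1 - cnj a * b)"
    have "N \<noteq> 0" using mob_denominator_nonzero[OF a1 b1] by (simp add: N_def)
    then have N0: "0 < N" by (simp add: N_def)
    have "cmod a * cmod b \<le> 1 * 1" using a1 b1 by (intro mult_mono) auto
    then have "N \<le> 2"
      using norm_triangle_ineq4[of 1 "cnj a * b"] by (simp add: norm_mult N_def)
    then have "N\<^sup>2 \<le> 2\<^sup>2" using N0 by (intro power_mono) auto
    then have N4: "N\<^sup>2 \<le> 4" by simp
    have "(1 - \<rho>\<^sup>2) * (1 - \<rho>\<^sup>2) \<le> (1 - (cmod a)\<^sup>2) * (1 - (cmod b)\<^sup>2)"
      using sq \<rho>2 by (intro mult_mono) auto
    then have "(1 - \<rho>\<^sup>2)\<^sup>2 / 4 \<le> (1 - (cmod a)\<^sup>2) * (1 - (cmod b)\<^sup>2) / N\<^sup>2"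
      using N0 N4 pos by (intro frac_le) (auto simp: power2_eq_square)
    also have "\<dots> = 1 - (cmod (mob a b))\<^sup>2"
      unfolding N_def by (rule one_minus_cmod_mob_square[OF a1 b1, symmetric])
    finally have "(cmod (mob a b))\<^sup>2 \<le> 1 - (1 - \<rho>\<^sup>2)\<^sup>2 / 4" by simp
    then show ?thesis unfolding \<sigma>_def by (rule real_le_rsqrt)
  qed
  show thesis
  proof
    show "0 \<le> ((1 + \<sigma>) / (1 - \<sigma>))\<^sup>2" by simp
    fix F a b assume F: "disc_map F" and ab: "cmod a \<le> \<rho>" "cmod b \<le> \<rho>"
    then have a1: "cmod a < 1" "cmod b < 1" using assms by auto
    have "(1 + cmod (mob a b)) / (1 - cmod (mob a b)) \<le> (1 + \<sigma>) / (1 - \<sigma>)"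
      using mob_le[OF ab] \<sigma> by (intro frac_le) auto
    then have "((1 + cmod (mob a b)) / (1 - cmod (mob a b)))\<^sup>2 \<le> ((1 + \<sigma>) / (1 - \<sigma>))\<^sup>2"
      using mob_le[OF ab] \<sigma> by (intro power_mono divide_nonneg_nonneg) auto
    then have "((1 + cmod (mob a b)) / (1 - cmod (mob a b)))\<^sup>2 * (1 - disc_distortion F a)
        \<le> ((1 + \<sigma>) / (1 - \<sigma>))\<^sup>2 * (1 - disc_distortion F a)"
      using Schwarz_Pick(2)[OF F a1(1) a1(1)] by (intro mult_right_mono) auto
    then show "1 - disc_distortion F b \<le> ((1 + \<sigma>) / (1 - \<sigma>))\<^sup>2 * (1 - disc_distortion F a)"
      using disc_distortion_compare[OF F a1] by linarith
  qed
qed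

lemma disc_dist_eq_artanh_mob: "disc_dist a b = artanh (cmod (mob a b))"
  using cmod_mob_commute[of b a] by (simp add: disc_dist_def Moebius_function_simple)

lemma artanh_real_strict_mono: "0 \<le> x \<Longrightarrow> x < y \<Longrightarrow> y < (1::real) \<Longrightarrow> artanh x < artanh y"
  using frac_less2[of "1 + x" "1 + y" "1 - y" "1 - x"] by (simp add: artanh_def)

lemma artanh_real_mono: "0 \<le> x \<Longrightarrow> x \<le> y \<Longrightarrow> y < (1::real) \<Longrightarrow> artanh x \<le> artanh y"
  using artanh_real_strict_mono[of x y] by (cases "x = y") auto

lemma disc_dist_contraction:
  assumes "disc_map F" "cmod a < 1" "cmod b < 1"
  shows "disc_dist (F a) (F b) \<le> disc_dist a b"
  unfolding disc_dist_eq_artanh_mob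
  using assms Schwarz_Pick(1)[OF assms] by (intro artanh_real_mono Moebius_function_norm_lt_1) auto

text \<open>
  Shows that every neighbourhood of a point contains a small hyperbolic disc around it.
\<close>

lemma dist_le_of_disc_dist:
  assumes "cmod a < 1" "cmod b < 1" "0 < \<epsilon>" "\<epsilon> < 1" "disc_dist a b < artanh \<epsilon>"
  shows "dist a b < 2 * \<epsilon>"
proof -
  have m1: "cmod (mob a b) < 1" using assms(1,2) by (rule Moebius_function_norm_lt_1)
  have "cmod (mob a b) < \<epsilon>"
    using artanh_real_mono[of \<epsilon> "cmod (mob a b)"] assms m1
    by (force simp: disc_dist_eq_artanh_mob)
  moreover have "cmod (1 - cnj a * b) \<le> 1 + cmod a * cmod b"
    using norm_triangle_ineq4[of 1 "cnj a * b"] by (simp add: norm_mult)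
  moreover have "cmod a * cmod b < 1" using assms mult_strict_mono[of "cmod a" 1 "cmod b" 1] by simp
  ultimately have "cmod (mob a b) * cmod (1 - cnj a * b) < \<epsilon> * 2"
    using assms by (intro mult_strict_mono') auto
  moreover have "cmod (mob a b) * cmod (1 - cnj a * b) = cmod (b - a)"
    using mob_denominator_nonzero[OF assms(1,2)] by (simp add: Moebius_function_simple norm_divide)
  ultimately show ?thesis by (simp add: dist_norm norm_minus_commute)
qed

text \<open>
  Near \<open>0\<close> the function \<open>artanh\<close> is asymptotically the identity, so the quotient of distances has the same
  limit as \<open>\<bar>mob (F a) (F b)\<bar> / \<bar>mob a b\<bar>\<close>, which is the modulus of a difference quotient up to continuous factors.
\<close>

lemma tendsto_disc_dist_quotient:
  assumes dm: "disc_map F" and a: "cmod a < 1"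
  shows "((\<lambda>b. disc_dist (F a) (F b) / disc_dist a b) \<longlongrightarrow> disc_distortion F a) (at a)"
proof -
  \<comment> \<open>\<open>artanh x / x\<close> with its removable singularity filled in, as \<open>F b = F a\<close> may happen near \<open>a\<close>\<close>
  define \<kappa> :: "real \<Rightarrow> real" where "\<kappa> x = (if x = 0 then 1 else artanh x / x)" for x
  have "(artanh has_field_derivative 1 / (1 - 0\<^sup>2)) (at (0::real))"
    by (rule artanh_real_has_field_derivative) auto
  then have "((\<lambda>x. artanh x / x) \<longlongrightarrow> 1) (at (0::real))"
    by (simp add: has_field_derivative_iff)
  then have "(\<kappa> \<longlongrightarrow> 1) (at 0)"
    by (rule Lim_transform_eventually) (auto simp: \<kappa>_def eventually_at_filter)
  then have \<kappa>: "isCont \<kappa> 0" by (simp add: isCont_def \<kappa>_def)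
  have \<kappa>_eq: "artanh x = \<kappa> x * x" for x :: real by (simp add: \<kappa>_def)
  have Fa: "cmod (F a) < 1" using dm a by (rule disc_map_in)
  have Fd: "(F has_field_derivative deriv F a) (at a)" using dm a by (rule disc_map_deriv)
  have FC: "F \<midarrow>a\<rightarrow> F a" using Fd DERIV_isCont isCont_def by blast
  have na: "1 - cnj a * a \<noteq> 0" and nFa: "1 - cnj (F a) * F a \<noteq> 0"
    using mob_denominator_nonzero a Fa by auto
  have m1: "((\<lambda>b. mob a b) \<longlongrightarrow> (a - a) / (1 - cnj a * a)) (at a)"
    unfolding Moebius_function_simple using na by (intro tendsto_intros)
  have m2: "((\<lambda>b. mob (F a) (F b)) \<longlongrightarrow> (F a - F a) / (1 - cnj (F a) * F a)) (at a)"
    unfolding Moebius_function_simple using nFa FC by (intro tendsto_intros)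
  have k1: "((\<lambda>b. \<kappa> (cmod (mob a b))) \<longlongrightarrow> \<kappa> 0) (at a)"
    by (rule isCont_tendsto_compose[OF \<kappa>]) (use tendsto_norm[OF m1] in simp)
  have k2: "((\<lambda>b. \<kappa> (cmod (mob (F a) (F b)))) \<longlongrightarrow> \<kappa> 0) (at a)"
    by (rule isCont_tendsto_compose[OF \<kappa>]) (use tendsto_norm[OF m2] in simp)
  have q: "((\<lambda>b. (F b - F a) / (b - a) * (1 - cnj a * b) / (1 - cnj (F a) * F b))
      \<longlongrightarrow> deriv F a * (1 - cnj a * a) / (1 - cnj (F a) * F a)) (at a)"
    using Fd nFa FC unfolding has_field_derivative_iff by (intro tendsto_intros)
  have L: "((\<lambda>b. \<kappa> (cmod (mob (F a) (F b))) / \<kappa> (cmod (mob a b))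
        * cmod ((F b - F a) / (b - a) * (1 - cnj a * b) / (1 - cnj (F a) * F b)))
      \<longlongrightarrow> \<kappa> 0 / \<kappa> 0 * cmod (deriv F a * (1 - cnj a * a) / (1 - cnj (F a) * F a))) (at a)"
    by (intro tendsto_intros k1 k2 tendsto_norm q) (simp add: \<kappa>_def)
  have cc: "cmod (1 - cnj z * z) = 1 - (cmod z)\<^sup>2" if "cmod z < 1" for z
  proof -
    have "1 - cnj z * z = complex_of_real (1 - (cmod z)\<^sup>2)"
      by (simp add: complex_norm_square mult.commute del: of_real_power)
    then show ?thesis using cmod_square_less_1[OF that] by (simp only: norm_of_real)
  qed
  have "\<kappa> 0 / \<kappa> 0 * cmod (deriv F a * (1 - cnj a * a) / (1 - cnj (F a) * F a))
      = disc_distortion F a"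
    using cc[OF a] cc[OF Fa] by (simp add: \<kappa>_def disc_distortion_def norm_mult norm_divide mult.commute)
  with L have L': "((\<lambda>b. \<kappa> (cmod (mob (F a) (F b))) / \<kappa> (cmod (mob a b))
        * cmod ((F b - F a) / (b - a) * (1 - cnj a * b) / (1 - cnj (F a) * F b)))
      \<longlongrightarrow> disc_distortion F a) (at a)" by simp
  show ?thesis
  proof (rule Lim_transform_eventually[OF L'])
    show "\<forall>\<^sub>F b in at a. \<kappa> (cmod (mob (F a) (F b))) / \<kappa> (cmod (mob a b))
        * cmod ((F b - F a) / (b - a) * (1 - cnj a * b) / (1 - cnj (F a) * F b))
      = disc_dist (F a) (F b) / disc_dist a b"
      by (rule always_eventually)
        (simp add: disc_dist_eq_artanh_mob \<kappa>_eq Moebius_function_simple norm_mult norm_divide mult_ac)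
  qed
qed

lemma tendsto_disc_distortion:
  assumes \<Phi>: "\<And>n. disc_map (\<Phi> n)" and G: "disc_map G"
    and lim: "\<And>K. \<lbrakk>compact K; K \<subseteq> unit_disc\<rbrakk> \<Longrightarrow> uniform_limit K \<Phi> G sequentially"
    and a: "cmod a < 1"
  shows "(\<lambda>n. disc_distortion (\<Phi> n) a) \<longlonglongrightarrow> disc_distortion G a"
proof -
  obtain e where e: "e > 0" "cball a e \<subseteq> unit_disc"
    using a by (meson mem_ball_0 open_ball open_contains_cball)
  have ul: "uniform_limit (ball a e) \<Phi> G sequentially"
    using lim[OF compact_cball e(2)] by (rule uniform_limit_on_subset) auto
  have "(\<lambda>n. deriv (\<Phi> n) a) \<longlonglongrightarrow> deriv G a"
  proof (rule deriv_complex_uniform_limit[OF ul])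
    show "\<forall>\<^sub>F n in sequentially. \<Phi> n holomorphic_on ball a e"
    proof (intro always_eventually allI)
      fix n show "\<Phi> n holomorphic_on ball a e"
        using \<Phi>[of n] e(2) ball_subset_cball[of a e] holomorphic_on_subset
        unfolding disc_map_def by blast
    qed
  qed (use e in auto)
  moreover have "(\<lambda>n. \<Phi> n a) \<longlonglongrightarrow> G a"
    using ul by (rule tendsto_uniform_limitI) (use e in auto)
  moreover have "1 - (cmod (G a))\<^sup>2 \<noteq> 0"
    using cmod_square_less_1[OF disc_map_in[OF G a]] by simp
  ultimately show ?thesis
    unfolding disc_distortion_def by (intro tendsto_intros)
qed

lemma disc_map_nonconstant_compose:
  assumes F: "disc_map F" "\<not> F constant_on unit_disc" and G: "disc_map G" "\<not> G constant_on unit_disc"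
  shows "\<not> (G \<circ> F) constant_on unit_disc"
proof
  assume "(G \<circ> F) constant_on unit_disc"
  then obtain k where k: "\<And>z. z \<in> unit_disc \<Longrightarrow> G (F z) = k" by (auto simp: constant_on_def)
  have op: "open (F ` unit_disc)"
    using F by (intro open_mapping_thm[of F unit_disc unit_disc]) (auto simp: disc_map_def)
  have sub: "F ` unit_disc \<subseteq> unit_disc" using F(1) by (auto simp: disc_map_def)
  have "G z = k" if "z \<in> unit_disc" for z
    by (rule analytic_continuation_open[of "F ` unit_disc" unit_disc G "\<lambda>_. k"])
      (use G(1) k that op sub in \<open>auto simp: disc_map_def\<close>)
  then show False using G(2) by (auto simp: constant_on_def)
qed

lemma fsigma_unit_disc: "fsigma unit_disc"
proof -
  obtain C :: "nat \<Rightarrow> complex set" where "\<And>n. compact (C n)" "(\<Union>n. C n) = unit_disc"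
    using open_Union_compact_subsets[OF open_ball] by metis
  then show ?thesis using fsigma.intros[of C] compact_imp_closed by metis
qed

lemma countable_critical_points:
  assumes F: "disc_map F" "\<not> F constant_on unit_disc"
  shows "countable {z \<in> unit_disc. deriv F z = 0}"
proof (cases "deriv F constant_on unit_disc")
  case True
  then obtain k where k: "\<And>z. z \<in> unit_disc \<Longrightarrow> deriv F z = k" by (auto simp: constant_on_def)
  show ?thesis
  proof (cases "k = 0")
    case True
    have "\<exists>c. \<forall>z\<in>unit_disc. F z = c"
      using k True disc_map_deriv[OF F(1)]
      by (intro has_field_derivative_zero_constant[of unit_disc F])
        (auto intro: has_field_derivative_at_within)
    then show ?thesis using F(2) by (auto simp: constant_on_def)
  next
    case False
    then have "{z \<in> unit_disc. deriv F z = 0} = {}" using k by auto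
    then show ?thesis by (metis countable_empty)
  qed
next
  case False
  have "deriv F holomorphic_on unit_disc"
    using F(1) by (auto simp: disc_map_def intro: holomorphic_deriv)
  then show ?thesis
    using False fsigma_unit_disc by (intro holomorphic_countable_zeros) auto
qed

section \<open>Lifting through a covering of a general topological space\<close>

lemma convex_line_param:
  fixes a d :: "'a::real_vector"
  assumes "convex V" "a + u *\<^sub>R d \<in> V" "a + w *\<^sub>R d \<in> V" "u \<le> v" "v \<le> w"
  shows "a + v *\<^sub>R d \<in> V"
proof -
  have "convex ((\<lambda>v. a + v *\<^sub>R d) -` V)"
  proof (rule convexI)
    fix x y r s :: real
    assume *: "x \<in> (\<lambda>v. a + v *\<^sub>R d) -` V" "y \<in> (\<lambda>v. a + v *\<^sub>R d) -` V"
      "0 \<le> r" "0 \<le> s" "r + s = 1"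
    have "a + (r *\<^sub>R x + s *\<^sub>R y) *\<^sub>R d = (r + s) *\<^sub>R a + (r *\<^sub>R x + s *\<^sub>R y) *\<^sub>R d"
      using *(5) by simp
    also have "\<dots> = r *\<^sub>R (a + x *\<^sub>R d) + s *\<^sub>R (a + y *\<^sub>R d)"
      by (simp add: algebra_simps)
    also have "\<dots> \<in> V" using * by (intro convexD[OF assms(1)]) auto
    finally show "r *\<^sub>R x + s *\<^sub>R y \<in> (\<lambda>v. a + v *\<^sub>R d) -` V" by simp
  qed
  then show ?thesis
    using mem_is_interval_1_I[of "(\<lambda>v. a + v *\<^sub>R d) -` V" u w v] assms(2-)
    by (simp add: is_interval_convex_1)
qed

text \<open>
  One continuation step: a lift on \<open>V\<close> is glued with a local inverse of \<open>p\<close> over a set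
  \<open>T \<supseteq> h ` B\<close>. The result is only claimed on a convex \<open>W\<close>, so that \<open>W \<inter> V \<inter> B\<close> is connected and the two
  lifts, which agree at \<open>t\<close>, agree on all of it.
\<close>

lemma covering_space_lift_extend:
  fixes p :: "'c::real_normed_vector \<Rightarrow> 'b::topological_space"
    and h :: "'a::real_normed_vector \<Rightarrow> 'b" and V B :: "'a set"
  assumes cov: "covering_space C p X"
    and V: "open V" "convex V" "continuous_on V H" "H \<in> V \<rightarrow> C" "\<And>z. z \<in> V \<Longrightarrow> p (H z) = h z"
    and B: "open B" "convex B" "continuous_on B h" "h \<in> B \<rightarrow> T" "homeomorphism U T p q" "U \<subseteq> C" "T \<subseteq> X"
    and W: "convex W" "open W" "W \<subseteq> V \<union> B" "t \<in> W" "t \<in> V" "t \<in> B" "H t \<in> U"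
    and h: "continuous_on W h" "h \<in> W \<rightarrow> X"
  shows "\<exists>K. continuous_on W K \<and> K \<in> W \<rightarrow> C \<and> (\<forall>z\<in>W. p (K z) = h z) \<and> (\<forall>z\<in>W \<inter> V. K z = H z)"
proof -
  have qp: "q (p x) = x" if "x \<in> U" for x using B(5) that by (simp add: homeomorphism_def)
  have pq: "p (q x) = x" "q x \<in> U" if "x \<in> T" for x
    using B(5) that by (auto simp: homeomorphism_def)
  have contq: "continuous_on T q" using B(5) by (simp add: homeomorphism_def)
  have qh: "continuous_on B (\<lambda>z. q (h z))"
    using B(3,4) by (intro continuous_on_compose2[OF contq]) auto
  have agree: "H z = q (h z)" if "z \<in> W \<inter> V \<inter> B" for z
  proof (rule covering_space_lift_unique[OF cov, of H t "\<lambda>z. q (h z)" "W \<inter> V \<inter> B" h])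
    show "H t = q (h t)" using qp W V(5) by metis
    show "connected (W \<inter> V \<inter> B)" using W V B by (intro convex_connected convex_Int)
    show "continuous_on (W \<inter> V \<inter> B) H" "continuous_on (W \<inter> V \<inter> B) h"
      "continuous_on (W \<inter> V \<inter> B) (\<lambda>z. q (h z))"
      using V(3) h(1) qh by (auto elim!: continuous_on_subset)
    show "H \<in> W \<inter> V \<inter> B \<rightarrow> C" "h \<in> W \<inter> V \<inter> B \<rightarrow> X" "t \<in> W \<inter> V \<inter> B" "z \<in> W \<inter> V \<inter> B"
      "\<And>x. x \<in> W \<inter> V \<inter> B \<Longrightarrow> h x = p (H x)"
      using that V(4,5) W(4-6) h(2) by auto
    have hT: "h x \<in> T" if "x \<in> B" for x using B(4) that by auto
    show "(\<lambda>z. q (h z)) \<in> W \<inter> V \<inter> B \<rightarrow> C" using hT pq(2) B(6) by blast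
    show "h x = p (q (h x))" if "x \<in> W \<inter> V \<inter> B" for x
      using hT[of x] pq(1)[of "h x"] that by simp
  qed
  define K where "K z = (if z \<in> V then H z else q (h z))" for z
  have KB: "K z = q (h z)" if "z \<in> W \<inter> B" for z using agree that by (auto simp: K_def)
  show ?thesis
  proof (intro exI[of _ K] conjI)
    have "continuous_on (W \<inter> V) H" "continuous_on (W \<inter> B) (\<lambda>z. q (h z))"
      using V(3) qh by (auto elim!: continuous_on_subset)
    moreover have "K z = H z" if "z \<in> W \<inter> V" for z using that by (simp add: K_def)
    ultimately have "continuous_on (W \<inter> V) K" "continuous_on (W \<inter> B) K"
      using KB continuous_on_cong[of "W \<inter> V" "W \<inter> V" K H]
        continuous_on_cong[of "W \<inter> B" "W \<inter> B" K "\<lambda>z. q (h z)"] by simp_all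
    then have "continuous_on (W \<inter> V \<union> W \<inter> B) K"
      using V(1) B(1) W(2) by (intro continuous_on_open_Un) auto
    moreover have "W \<inter> V \<union> W \<inter> B = W" using W(3) by auto
    ultimately show "continuous_on W K" by simp
    have hT: "h z \<in> T" if "z \<in> B" for z using B(4) that by auto
    have "K z \<in> C \<and> p (K z) = h z" if "z \<in> W" for z
    proof (cases "z \<in> V")
      case True then show ?thesis using V(4,5) by (auto simp: K_def)
    next
      case False
      then have "z \<in> B" using that W(3) by blast
      then show ?thesis using False pq[OF hT] B(6) by (auto simp: K_def)
    qed
    then show "K \<in> W \<rightarrow> C" "\<forall>z\<in>W. p (K z) = h z" by auto
    show "\<forall>z\<in>W \<inter> V. K z = H z" by (simp add: K_def)
  qed
qed

text \<open>
  Call a convex open set containing \<open>a\<close> good if \<open>h\<close> has a lift on it with value \<open>c\<close> at \<open>a\<close>. Lifts on two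
  good sets agree on their intersection, which is again convex, so it suffices that good sets cover
  \<open>S\<close>. To reach \<open>s\<close>, continue along the segment from \<open>a\<close> to \<open>s\<close>: if a good \<open>V\<close> contains the
  segment up to a point in an evenly covered ball \<open>B\<close>, then a thin neighbourhood of a longer segment
  is convex, lies in \<open>V \<union> B\<close>, and is good by the previous lemma.
\<close>

lemma covering_space_lift_convex:
  fixes p :: "'c::real_normed_vector \<Rightarrow> 'b::topological_space"
    and h :: "'a::real_normed_vector \<Rightarrow> 'b"
  assumes cov: "covering_space C p X" and S: "open S" "convex S"
    and h: "continuous_on S h" "h \<in> S \<rightarrow> X"
    and a: "a \<in> S" and c: "c \<in> C" "p c = h a"
  obtains H where "continuous_on S H" "H \<in> S \<rightarrow> C" "\<And>z. z \<in> S \<Longrightarrow> p (H z) = h z" "H a = c"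
proof -
  define lift where "lift V H \<longleftrightarrow> open V \<and> convex V \<and> a \<in> V \<and> V \<subseteq> S \<and> continuous_on V H \<and>
    H \<in> V \<rightarrow> C \<and> (\<forall>z\<in>V. p (H z) = h z) \<and> H a = c" for V H
  have unique: "H z = K z" if "lift V H" "lift W K" "z \<in> V" "z \<in> W" for V H W K z
  proof (rule covering_space_lift_unique[OF cov, of H a K "V \<inter> W" h])
    show "connected (V \<inter> W)" using that by (auto simp: lift_def intro: convex_connected convex_Int)
    show "continuous_on (V \<inter> W) H" "continuous_on (V \<inter> W) h" "continuous_on (V \<inter> W) K"
      using that h(1) by (auto simp: lift_def elim!: continuous_on_subset)
    show "H a = K a" "a \<in> V \<inter> W" "z \<in> V \<inter> W" using that by (auto simp: lift_def)
    show "H \<in> V \<inter> W \<rightarrow> C" "K \<in> V \<inter> W \<rightarrow> C"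
      "\<And>x. x \<in> V \<inter> W \<Longrightarrow> h x = p (H x)" "\<And>x. x \<in> V \<inter> W \<Longrightarrow> h x = p (K x)"
      using that(1,2) by (auto simp: lift_def)
    show "h \<in> V \<inter> W \<rightarrow> X" using that(1) h(2) by (auto simp: lift_def)
  qed
  have evenly: "\<exists>B T. open B \<and> convex B \<and> x \<in> B \<and> B \<subseteq> S \<and> h \<in> B \<rightarrow> T \<and> T \<subseteq> X \<and>
      (\<forall>y\<in>C. p y \<in> T \<longrightarrow> (\<exists>U q. y \<in> U \<and> U \<subseteq> C \<and> homeomorphism U T p q))"
    if x: "x \<in> S" for x
  proof -
    have "h x \<in> X" using x h by auto
    then obtain T \<V> where T: "h x \<in> T" "openin (top_of_set X) T" "\<Union>\<V> = C \<inter> p -` T"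
      and hom: "\<And>U. U \<in> \<V> \<Longrightarrow> \<exists>q. homeomorphism U T p q"
      using cov unfolding covering_space_def by (elim conjE) (drule bspec, assumption, blast)
    have "openin (top_of_set S) (S \<inter> h -` T)"
      using h T(2) by (intro continuous_openin_preimage) auto
    then have "open (S \<inter> h -` T)" using S(1) openin_open_eq by blast
    then obtain e where e: "e > 0" "ball x e \<subseteq> S \<inter> h -` T"
      using x T(1) openE[of "S \<inter> h -` T" x] by blast
    have "\<forall>y\<in>C. p y \<in> T \<longrightarrow> (\<exists>U q. y \<in> U \<and> U \<subseteq> C \<and> homeomorphism U T p q)"
    proof (intro ballI impI)
      fix y assume "y \<in> C" "p y \<in> T"
      then have "y \<in> \<Union>\<V>" using T(3) by auto
      then obtain U where U: "U \<in> \<V>" "y \<in> U" by blast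
      moreover have "U \<subseteq> C" using U T(3) by blast
      ultimately show "\<exists>U q. y \<in> U \<and> U \<subseteq> C \<and> homeomorphism U T p q" using hom by blast
    qed
    moreover have "T \<subseteq> X" using T(2) openin_imp_subset by blast
    moreover have "h \<in> ball x e \<rightarrow> T" using e(2) by auto
    ultimately show ?thesis
      using e by (intro exI[of _ "ball x e"] exI[of _ T]) auto
  qed
  have reach: "\<exists>V H. lift V H \<and> s \<in> V" if s: "s \<in> S" for s
  proof -
    define d where "d = s - a"
    define e where "e v = a + v *\<^sub>R d" for v :: real
    have eS: "e v \<in> S" if "0 \<le> v" "v \<le> 1" for v
      unfolding e_def by (rule convex_line_param[of S a 0 d 1]) (use a s that S(2) in \<open>auto simp: d_def\<close>)
    \<comment> \<open>\<open>P\<close> is locally constant on the unit interval and holds at \<open>0\<close>\<close>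
    define P where "P v \<longleftrightarrow> (\<exists>V H. lift V H \<and> e v \<in> V)" for v
    have conte: "continuous_on A e" for A unfolding e_def by (intro continuous_intros)
    have "P 1"
    proof (rule connected_induction_simple[of "{0..1::real}" 0 1 P])
      show "P 0"
      proof -
        obtain B T where B: "open B" "convex B" "a \<in> B" "B \<subseteq> S" "h \<in> B \<rightarrow> T" "T \<subseteq> X"
          and sheet: "\<And>y. y \<in> C \<Longrightarrow> p y \<in> T \<Longrightarrow> (\<exists>U q. y \<in> U \<and> U \<subseteq> C \<and> homeomorphism U T p q)"
          using evenly[OF a] by blast
        obtain U q where U: "c \<in> U" "U \<subseteq> C" "homeomorphism U T p q"
          using sheet[of c] c B by (auto simp: Pi_iff)
        have "continuous_on B (\<lambda>z. q (h z))"
          using U(3) B h(1)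
          by (intro continuous_on_compose2[of T q B h])
            (auto simp: homeomorphism_def elim!: continuous_on_subset)
        moreover have "q (h a) = c" using U c by (metis homeomorphism_apply1)
        ultimately have "lift B (\<lambda>z. q (h z))"
          using B U by (auto simp: lift_def homeomorphism_def Pi_iff)
        then show "P 0" using B(3) by (auto simp: P_def e_def)
      qed
      fix u0 :: real assume u0: "u0 \<in> {0..1}"
      obtain B T where B: "open B" "convex B" "e u0 \<in> B" "B \<subseteq> S" "h \<in> B \<rightarrow> T" "T \<subseteq> X"
        and sheet: "\<And>y. y \<in> C \<Longrightarrow> p y \<in> T \<Longrightarrow> (\<exists>U q. y \<in> U \<and> U \<subseteq> C \<and> homeomorphism U T p q)"
        using evenly[OF eS] u0 by (metis atLeastAtMost_iff)
      show "\<exists>R. openin (top_of_set {0..1}) R \<and> u0 \<in> R \<and> (\<forall>x\<in>R. \<forall>y\<in>R. P x \<longrightarrow> P y)"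
      proof (intro exI conjI ballI impI)
        show "openin (top_of_set {0..1}) ({0..1} \<inter> e -` B)"
          using conte B(1) by (intro continuous_openin_preimage_gen)
        show "u0 \<in> {0..1} \<inter> e -` B" using u0 B by auto
        fix u w assume u: "u \<in> {0..1} \<inter> e -` B" and w: "w \<in> {0..1} \<inter> e -` B" and "P u"
        then obtain V H where V: "lift V H" "e u \<in> V" by (auto simp: P_def)
        then have V': "open V" "convex V" "a \<in> V" "V \<subseteq> S" "continuous_on V H" "H \<in> V \<rightarrow> C"
          "\<And>z. z \<in> V \<Longrightarrow> p (H z) = h z" "H a = c" by (auto simp: lift_def)
        have inV: "e v \<in> V" if "0 \<le> v" "v \<le> u" for v
          unfolding e_def by (rule convex_line_param[of V a 0 d u]) (use that V V' in \<open>auto simp: e_def\<close>)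
        show "P w"
        proof (cases "w \<le> u")
          case True
          then show ?thesis using inV[of w] w V(1) by (auto simp: P_def)
        next
          case False
          have inB: "e v \<in> B" if "u \<le> v" "v \<le> w" for v
            unfolding e_def by (rule convex_line_param[of B a u d w]) (use that u w B in \<open>auto simp: e_def\<close>)
          define K where "K = e ` {0..w}"
          have "compact K" unfolding K_def by (intro compact_continuous_image conte) auto
          moreover have "K \<subseteq> V \<union> B" using inV inB by (force simp: K_def)
          moreover have "open (V \<union> B)" using B V' by auto
          ultimately obtain \<epsilon> where \<epsilon>: "\<epsilon> > 0" "(\<Union>x\<in>K. ball x \<epsilon>) \<subseteq> V \<union> B"
            using compact_subset_open_imp_ball_epsilon_subset by blast
          define W where "W = (\<Union>x\<in>K. ball x \<epsilon>)"
          have "convex K"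
          proof -
            have "e = (\<lambda>x. a + x) \<circ> (\<lambda>v. v *\<^sub>R d)" by (auto simp: e_def)
            then have "K = (\<lambda>x. a + x) ` (\<lambda>v. v *\<^sub>R d) ` {0..w}"
              unfolding K_def by (simp only: image_comp)
            moreover have "linear (\<lambda>v. v *\<^sub>R d)" by (rule linearI) (auto simp: algebra_simps)
            then have "convex ((\<lambda>v. v *\<^sub>R d) ` {0..w})"
              by (rule convex_linear_image) simp
            ultimately show ?thesis using convex_translation by simp
          qed
          then have "convex (\<Union>x\<in>K. \<Union>y\<in>ball 0 \<epsilon>. {x + y})" by (intro convex_sums) auto
          moreover have "(\<Union>x\<in>K. \<Union>y\<in>ball 0 \<epsilon>. {x + y}) = W"
          proof -
            have "(\<Union>y\<in>ball 0 \<epsilon>. {x + y}) = ball x \<epsilon>" for x :: 'a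
              by (auto simp: dist_norm norm_minus_commute intro!: bexI[of _ "_ - x"])
            then show ?thesis by (simp add: W_def)
          qed
          ultimately have W: "convex W" "open W" "W \<subseteq> V \<union> B" using \<epsilon>(2) by (auto simp: W_def)
          have KW: "K \<subseteq> W" using \<epsilon>(1) by (auto simp: W_def)
          have eK: "e u \<in> K" "e w \<in> K" "a \<in> K"
          proof -
            show "e u \<in> K" "e w \<in> K" using u w False by (auto simp: K_def)
            show "a \<in> K" unfolding K_def
              by (rule image_eqI[of _ _ 0]) (use w in \<open>auto simp: e_def\<close>)
          qed
          have "H (e u) \<in> C" "p (H (e u)) \<in> T"
            using V V' u B(5) by (auto simp: Pi_iff)
          then obtain U q where U: "H (e u) \<in> U" "U \<subseteq> C" "homeomorphism U T p q"
            using sheet by blast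
          have WS: "W \<subseteq> S" using W(3) B(4) V'(4) by blast
          have "\<exists>G. continuous_on W G \<and> G \<in> W \<rightarrow> C \<and> (\<forall>z\<in>W. p (G z) = h z) \<and>
            (\<forall>z\<in>W \<inter> V. G z = H z)"
          proof (rule covering_space_lift_extend[OF cov V'(1,2,5,6,7) B(1,2) _ B(5) U(3,2) B(6) W])
            show "continuous_on B h" "continuous_on W h" using h(1) B(4) WS continuous_on_subset by auto
            show "h \<in> W \<rightarrow> X" using h(2) WS by auto
            show "e u \<in> W" "e u \<in> V" "e u \<in> B" "H (e u) \<in> U" using eK KW V u U by auto
          qed
          then obtain G where G: "continuous_on W G" "G \<in> W \<rightarrow> C" "\<And>z. z \<in> W \<Longrightarrow> p (G z) = h z"
            "\<And>z. z \<in> W \<inter> V \<Longrightarrow> G z = H z" by auto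
          have "a \<in> W" "e w \<in> W" using eK KW by auto
          then have "lift W G" using W WS G V' by (auto simp: lift_def)
          then show ?thesis using \<open>e w \<in> W\<close> by (auto simp: P_def)
        qed
      qed
    qed auto
    then show ?thesis by (auto simp: P_def e_def d_def)
  qed
  then obtain V H where VH: "\<And>s. s \<in> S \<Longrightarrow> lift (V s) (H s)" "\<And>s. s \<in> S \<Longrightarrow> s \<in> V s"
    by metis
  have HH: "H s s = H s' s" if "s \<in> S" "s' \<in> S" "s \<in> V s'" for s s'
    using unique VH that by metis
  show thesis
  proof
    show "continuous_on S (\<lambda>s. H s s)"
      unfolding continuous_on_eq_continuous_at[OF S(1)]
    proof
      fix s assume s: "s \<in> S"
      have l: "lift (V s) (H s)" and sV: "s \<in> V s" using VH s by auto
      have "continuous_on (V s) (\<lambda>s'. H s' s')"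
        using l HH[OF _ s] by (subst continuous_on_cong[of _ "V s" _ "H s"]) (auto simp: lift_def)
      then show "isCont (\<lambda>s. H s s) s"
        using l sV continuous_on_eq_continuous_at[of "V s"] by (auto simp: lift_def)
    qed
    show "(\<lambda>s. H s s) \<in> S \<rightarrow> C" "\<And>z. z \<in> S \<Longrightarrow> p (H z z) = h z"
      using VH unfolding lift_def by blast+
    show "H a a = c" using VH[OF a] by (auto simp: lift_def)
  qed
qed

lemma covering_space_open_image:
  fixes p :: "'c::topological_space \<Rightarrow> 'b::topological_space"
  assumes cov: "covering_space C p X" and N: "openin (top_of_set C) N"
  shows "openin (top_of_set X) (p ` N)"
proof (subst openin_subopen, intro ballI)
  fix y assume "y \<in> p ` N"
  then obtain x where x: "x \<in> N" "y = p x" by blast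
  have "x \<in> C" using x N openin_imp_subset by blast
  then obtain T U q where T: "x \<in> T" "openin (top_of_set C) T" "p x \<in> U" "openin (top_of_set X) U"
    and hom: "homeomorphism T U p q"
    using covering_space_local_homeomorphism[OF cov] by metis
  have "openin (top_of_set T) (T \<inter> N)"
    using N T(2) openin_imp_subset by (metis openin_Int openin_subset_trans inf_le1)
  then have "openin (top_of_set U) (p ` (T \<inter> N))"
    using homeomorphism_imp_open_map[OF hom] by blast
  then have "openin (top_of_set X) (p ` (T \<inter> N))" using T(4) openin_trans by blast
  then show "\<exists>T. openin (top_of_set X) T \<and> y \<in> T \<and> T \<subseteq> p ` N"
    using x T(1) by blast
qed

section \<open>Holomorphic maps of a surface covered by the disc\<close>

lemma holomorphic_onI_local:
  assumes "\<And>x. x \<in> S \<Longrightarrow> \<exists>M. open M \<and> x \<in> M \<and> g holomorphic_on M"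
  shows "g holomorphic_on S"
  unfolding holomorphic_on_def
  using assms field_differentiable_at_within holomorphic_on_imp_differentiable_at by metis

locale disc_covered_surface =
  fixes X :: "'a::t2_space set" and A :: "'a chart set" and p :: "complex \<Rightarrow> 'a"
  assumes surface: "riemann_surface X A" and covering: "disc_covering X A p"
begin

lemma cov: "covering_space unit_disc p X"
  using covering by (simp add: disc_covering_def)

lemma p_cont: "continuous_on unit_disc p"
  using cov by (rule covering_space_imp_continuous)

lemma p_image: "p ` unit_disc = X"
  using cov by (rule covering_space_imp_surjective)

lemma p_in: "cmod z < 1 \<Longrightarrow> p z \<in> X"
  using p_image by auto

lemma point_over: "x \<in> X \<Longrightarrow> \<exists>z. cmod z < 1 \<and> p z = x"
  using p_image by force

lemma chartD:
  assumes "(U, \<phi>) \<in> A"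
  shows "openin (top_of_set X) U" "U \<subseteq> X" "open (\<phi> ` U)"
    "homeomorphism U (\<phi> ` U) \<phi> (the_inv_into U \<phi>)" "inj_on \<phi> U"
    "\<And>x. x \<in> U \<Longrightarrow> the_inv_into U \<phi> (\<phi> x) = x"
proof -
  show "openin (top_of_set X) U" "open (\<phi> ` U)"
    and hom: "homeomorphism U (\<phi> ` U) \<phi> (the_inv_into U \<phi>)"
    using surface assms by (auto simp: riemann_surface_def)
  then show "U \<subseteq> X" using openin_imp_subset by blast
  show *: "\<And>x. x \<in> U \<Longrightarrow> the_inv_into U \<phi> (\<phi> x) = x"
    using hom by (rule homeomorphism_apply1)
  then show "inj_on \<phi> U" by (rule inj_on_inverseI)
qed

lemma chart_at:
  assumes "x \<in> X" obtains U \<phi> where "(U, \<phi>) \<in> A" "x \<in> U"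
proof -
  have "x \<in> (\<Union>(U, \<phi>)\<in>A. U)" using surface assms by (simp add: riemann_surface_def)
  then show thesis using that by auto
qed

lemma open_vimage:
  assumes "continuous_on unit_disc h" "h \<in> unit_disc \<rightarrow> X" "openin (top_of_set X) U"
  shows "open (unit_disc \<inter> h -` U)"
proof -
  have "openin (top_of_set unit_disc) (unit_disc \<inter> h -` U)"
    using assms by (intro continuous_openin_preimage)
  then show ?thesis by (simp add: openin_open_eq)
qed

lemma open_image: "open N \<Longrightarrow> N \<subseteq> unit_disc \<Longrightarrow> openin (top_of_set X) (p ` N)"
  by (intro covering_space_open_image[OF cov]) (simp add: openin_open_eq)

lemma holomorphic_from_disc_iff:
  "holomorphic_map unit_disc disc_atlas X A h \<longleftrightarrow>
    h \<in> unit_disc \<rightarrow> X \<and> continuous_on unit_disc h \<and>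
    (\<forall>(V, \<psi>)\<in>A. (\<psi> \<circ> h) holomorphic_on (unit_disc \<inter> h -` V))"
proof -
  have "(\<psi> \<circ> h \<circ> the_inv_into unit_disc id) holomorphic_on id ` (unit_disc \<inter> h -` V) \<longleftrightarrow>
      (\<psi> \<circ> h) holomorphic_on (unit_disc \<inter> h -` V)" for V and \<psi> :: "'a \<Rightarrow> complex"
    using the_inv_into_f_f[of id unit_disc] by (intro holomorphic_cong) auto
  then show ?thesis by (simp add: holomorphic_map_def disc_atlas_def)
qed

lemma p_holomorphic_map: "holomorphic_map unit_disc disc_atlas X A p"
  using covering by (simp add: disc_covering_def)

text \<open>
  In every chart \<open>p\<close> is locally biholomorphic; \<open>k\<close> is the local inverse of \<open>\<phi> \<circ> p\<close>. This is what makes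
  holomorphy on the surface equivalent to holomorphy of lifts.
\<close>

lemma uniformizer:
  assumes chart: "(U, \<phi>) \<in> A" and b: "cmod b < 1" "p b \<in> U"
  obtains N k where "open N" "b \<in> N" "N \<subseteq> unit_disc" "p ` N \<subseteq> U" "inj_on (\<phi> \<circ> p) N"
    "(\<phi> \<circ> p) holomorphic_on N" "k holomorphic_on (\<phi> \<circ> p) ` N" "\<And>z. z \<in> N \<Longrightarrow> k (\<phi> (p z)) = z"
proof -
  obtain T W q where T: "b \<in> T" "openin (top_of_set unit_disc) T" "homeomorphism T W p q"
    using covering_space_local_homeomorphism[OF cov, of b] b(1) by (metis mem_ball_0)
  define N where "N = T \<inter> (unit_disc \<inter> p -` U)"
  have "open T" "T \<subseteq> unit_disc" using T(2) by (auto simp: openin_open_eq)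
  then have N: "open N" "b \<in> N" "N \<subseteq> unit_disc" "p ` N \<subseteq> U"
    using T b open_vimage[OF p_cont _ chartD(1)[OF chart]] p_in by (auto simp: N_def)
  have "inj_on p T" using T(3) by (metis homeomorphism_apply1 inj_on_inverseI)
  then have inj: "inj_on p N" by (auto simp: N_def intro: inj_on_subset)
  then have inj': "inj_on (\<phi> \<circ> p) N"
    using chartD(5)[OF chart] N(4) by (auto intro!: comp_inj_on elim: inj_on_subset)
  have hol: "(\<phi> \<circ> p) holomorphic_on N"
    using p_holomorphic_map chart unfolding holomorphic_from_disc_iff
    by (auto simp: N_def elim!: holomorphic_on_subset)
  obtain k where "k holomorphic_on (\<phi> \<circ> p) ` N" "\<And>z. z \<in> N \<Longrightarrow> k ((\<phi> \<circ> p) z) = z"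
    using holomorphic_has_inverse[OF hol N(1) inj'] by metis
  then show thesis using that N inj' hol by (auto simp: o_def)
qed

text \<open>
  The continuous lift is holomorphic, since it equals \<open>k \<circ> \<phi> \<circ> h\<close> locally with \<open>k\<close> as in \<open>uniformizer\<close>.
\<close>

lemma disc_lift:
  assumes h: "holomorphic_map unit_disc disc_atlas X A h"
    and a: "cmod a < 1" and c: "cmod c < 1" "p c = h a"
  obtains H where "disc_map H" "H a = c" "\<And>z. cmod z < 1 \<Longrightarrow> p (H z) = h z"
proof -
  have hc: "continuous_on unit_disc h" "h \<in> unit_disc \<rightarrow> X"
    using h by (auto simp: holomorphic_map_def)
  obtain H where H: "continuous_on unit_disc H" "H \<in> unit_disc \<rightarrow> unit_disc"
      "\<And>z. z \<in> unit_disc \<Longrightarrow> p (H z) = h z" "H a = c"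
    using covering_space_lift_convex[OF cov open_ball convex_ball hc, of a c] a c by auto
  have "H holomorphic_on unit_disc"
  proof (rule holomorphic_onI_local)
    fix z assume z: "z \<in> unit_disc"
    then have b: "cmod (H z) < 1" using H(2) by auto
    obtain U \<phi> where U: "(U, \<phi>) \<in> A" "p (H z) \<in> U" using chart_at p_in[OF b] by blast
    obtain N k where N: "open N" "H z \<in> N" "N \<subseteq> unit_disc" "p ` N \<subseteq> U"
      "k holomorphic_on (\<phi> \<circ> p) ` N" "\<And>z. z \<in> N \<Longrightarrow> k (\<phi> (p z)) = z"
      using uniformizer[OF U(1) b U(2)] by metis
    define M where "M = unit_disc \<inter> H -` N"
    have "open M" unfolding M_def
      using continuous_open_preimage[OF H(1) open_ball N(1)] .
    have M: "H w \<in> N" "p (H w) = h w" "w \<in> unit_disc" if "w \<in> M" for w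
      using that H by (auto simp: M_def)
    have "(\<phi> \<circ> h) holomorphic_on (unit_disc \<inter> h -` U)"
      using h U unfolding holomorphic_from_disc_iff by blast
    moreover have "M \<subseteq> unit_disc \<inter> h -` U"
    proof
      fix w assume "w \<in> M" then show "w \<in> unit_disc \<inter> h -` U"
        using M[of w] N(4) by auto
    qed
    ultimately have hol: "(\<phi> \<circ> h) holomorphic_on M" by (rule holomorphic_on_subset)
    have "(\<phi> \<circ> h) w \<in> (\<phi> \<circ> p) ` N" if "w \<in> M" for w
      using M[OF that] by (intro image_eqI[of _ _ "H w"]) auto
    then have "(\<phi> \<circ> h) ` M \<subseteq> (\<phi> \<circ> p) ` N" by blast
    then have "(k \<circ> (\<phi> \<circ> h)) holomorphic_on M"
      using hol N(5) by (rule holomorphic_on_compose_gen[rotated 2])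
    moreover have "(k \<circ> (\<phi> \<circ> h)) w = H w" if "w \<in> M" for w
      using M[OF that] N(6)[of "H w"] by simp
    ultimately have "H holomorphic_on M" using holomorphic_transform by blast
    then show "\<exists>M. open M \<and> z \<in> M \<and> H holomorphic_on M"
      using \<open>open M\<close> z N(2) by (auto simp: M_def)
  qed
  then have "disc_map H" using H(2) by (simp add: disc_map_def)
  then show thesis using that H by auto
qed

lemma holomorphic_map_comp_p:
  assumes f: "holomorphic_map X A X A f"
  shows "holomorphic_map unit_disc disc_atlas X A (f \<circ> p)"
proof -
  have fX: "f \<in> X \<rightarrow> X" and fc: "continuous_on X f" using f by (auto simp: holomorphic_map_def)
  then have *: "f \<circ> p \<in> unit_disc \<rightarrow> X" using p_in by auto
  have fpc: "continuous_on unit_disc (f \<circ> p)"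
    using p_cont fc unfolding p_image[symmetric] by (rule continuous_on_compose)
  have "(\<psi> \<circ> (f \<circ> p)) holomorphic_on (unit_disc \<inter> (f \<circ> p) -` V)" if V: "(V, \<psi>) \<in> A" for V \<psi>
  proof (rule holomorphic_onI_local)
    fix b assume b: "b \<in> unit_disc \<inter> (f \<circ> p) -` V"
    then have b1: "cmod b < 1" by simp
    obtain U \<phi> where U: "(U, \<phi>) \<in> A" "p b \<in> U" using chart_at p_in[OF b1] by blast
    obtain N k where N: "open N" "b \<in> N" "N \<subseteq> unit_disc" "p ` N \<subseteq> U" "(\<phi> \<circ> p) holomorphic_on N"
      using uniformizer[OF U(1) b1 U(2)] by metis
    define M where "M = N \<inter> (unit_disc \<inter> (f \<circ> p) -` V)"
    have "open M" unfolding M_def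
      using N(1) open_vimage[OF fpc * chartD(1)[OF V]] by (rule open_Int)
    have "(\<psi> \<circ> f \<circ> the_inv_into U \<phi>) holomorphic_on \<phi> ` (U \<inter> f -` V)"
      using f U V by (auto simp: holomorphic_map_def)
    moreover have "(\<phi> \<circ> p) ` M \<subseteq> \<phi> ` (U \<inter> f -` V)"
      using N(4) by (auto simp: M_def)
    moreover have "(\<phi> \<circ> p) holomorphic_on M"
      using N(5) by (rule holomorphic_on_subset) (auto simp: M_def)
    ultimately have "((\<psi> \<circ> f \<circ> the_inv_into U \<phi>) \<circ> (\<phi> \<circ> p)) holomorphic_on M"
      by (intro holomorphic_on_compose_gen)
    moreover have "((\<psi> \<circ> f \<circ> the_inv_into U \<phi>) \<circ> (\<phi> \<circ> p)) w = (\<psi> \<circ> (f \<circ> p)) w" if "w \<in> M" for w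
      using that N(4) chartD(6)[OF U(1), of "p w"] by (auto simp: M_def)
    ultimately have "(\<psi> \<circ> (f \<circ> p)) holomorphic_on M" using holomorphic_transform by blast
    then show "\<exists>M. open M \<and> b \<in> M \<and> (\<psi> \<circ> (f \<circ> p)) holomorphic_on M"
      using \<open>open M\<close> b N(2) by (auto simp: M_def)
  qed
  then show ?thesis using * fpc by (auto simp: holomorphic_from_disc_iff)
qed

text \<open>
  Continuity descends because \<open>p\<close> is open and surjective; holomorphy is checked in the coordinates
  provided by \<open>uniformizer\<close>.
\<close>

lemma holomorphic_map_descend:
  assumes G: "disc_map G" and g: "\<And>z. cmod z < 1 \<Longrightarrow> g (p z) = p (G z)"
  shows "holomorphic_map X A X A g"
proof -
  have Gc: "continuous_on unit_disc G" "G \<in> unit_disc \<rightarrow> unit_disc"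
    using G holomorphic_on_imp_continuous_on by (auto simp: disc_map_def)
  have pGc: "continuous_on unit_disc (\<lambda>z. p (G z))"
    using Gc by (intro continuous_on_compose2[OF p_cont Gc(1)]) auto
  have pG: "(\<lambda>z. p (G z)) \<in> unit_disc \<rightarrow> X" using G p_in disc_map_in by auto
  have gX: "g \<in> X \<rightarrow> X"
  proof
    fix x assume "x \<in> X"
    then obtain z where "cmod z < 1" "p z = x" using point_over by blast
    then show "g x \<in> X" using g p_in disc_map_in[OF G] by metis
  qed
  moreover have "continuous_on X g"
    unfolding continuous_on_open_gen[OF gX]
  proof (intro allI impI)
    fix V assume V: "openin (top_of_set X) V"
    have "X \<inter> g -` V = p ` (unit_disc \<inter> (\<lambda>z. p (G z)) -` V)"
      using p_image g by (auto simp: image_iff)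
    also have "openin (top_of_set X) \<dots>"
      using open_vimage[OF pGc pG V] by (intro open_image) auto
    finally show "openin (top_of_set X) (X \<inter> g -` V)" .
  qed
  moreover have "(\<psi> \<circ> g \<circ> the_inv_into U \<phi>) holomorphic_on \<phi> ` (U \<inter> g -` V)"
    if U: "(U, \<phi>) \<in> A" and V: "(V, \<psi>) \<in> A" for U \<phi> V \<psi>
  proof (rule holomorphic_onI_local)
    fix y assume "y \<in> \<phi> ` (U \<inter> g -` V)"
    then obtain x where x: "y = \<phi> x" "x \<in> U" "g x \<in> V" by auto
    then obtain b where b: "cmod b < 1" "p b = x" using point_over chartD(2)[OF U] by blast
    obtain N k where N: "open N" "b \<in> N" "N \<subseteq> unit_disc" "p ` N \<subseteq> U" "inj_on (\<phi> \<circ> p) N"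
      "(\<phi> \<circ> p) holomorphic_on N"
      "k holomorphic_on (\<phi> \<circ> p) ` N" "\<And>z. z \<in> N \<Longrightarrow> k (\<phi> (p z)) = z"
      using uniformizer[OF U(1) b(1)] b x by metis
    define N' where "N' = N \<inter> (unit_disc \<inter> (\<lambda>z. p (G z)) -` V)"
    have N': "N' \<subseteq> N" "open N'" "N' \<subseteq> unit_disc"
      using open_Int[OF N(1) open_vimage[OF pGc pG chartD(1)[OF V]]] by (auto simp: N'_def)
    define M where "M = (\<phi> \<circ> p) ` N'"
    have "open M" unfolding M_def
      using N' N(5,6) by (intro open_mapping_thm3) (auto elim: holomorphic_on_subset inj_on_subset)
    have "k holomorphic_on M" using N(7) N'(1) by (auto simp: M_def elim!: holomorphic_on_subset)
    have kM: "k ` M = N'" using N(8) N'(1) by (force simp: M_def)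
    have "(\<psi> \<circ> p) holomorphic_on (unit_disc \<inter> p -` V)"
      using p_holomorphic_map V unfolding holomorphic_from_disc_iff by blast
    moreover have "G holomorphic_on N'" using G N'(3) by (auto simp: disc_map_def elim: holomorphic_on_subset)
    moreover have "G ` N' \<subseteq> unit_disc \<inter> p -` V" using disc_map_in[OF G] by (auto simp: N'_def)
    ultimately have "((\<psi> \<circ> p) \<circ> G) holomorphic_on N'" by (intro holomorphic_on_compose_gen)
    then have "((\<psi> \<circ> p) \<circ> G \<circ> k) holomorphic_on M"
      unfolding kM[symmetric] by (rule holomorphic_on_compose[OF \<open>k holomorphic_on M\<close>])
    moreover have "((\<psi> \<circ> p) \<circ> G \<circ> k) w = (\<psi> \<circ> g \<circ> the_inv_into U \<phi>) w" if w: "w \<in> M" for w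
    proof -
      obtain z where z: "z \<in> N'" "w = \<phi> (p z)" using w by (auto simp: M_def)
      then have "z \<in> N" "p z \<in> U" "cmod z < 1" using N'(1,3) N(4) by auto
      then show ?thesis
        using z N(8)[of z] chartD(6)[OF U, of "p z"] g by simp
    qed
    ultimately have "(\<psi> \<circ> g \<circ> the_inv_into U \<phi>) holomorphic_on M" using holomorphic_transform by blast
    moreover have "b \<in> N'" using b x N(2) g[OF b(1)] by (simp add: N'_def)
    then have "y \<in> M" using x b by (auto simp: M_def)
    ultimately show "\<exists>M. open M \<and> y \<in> M \<and> (\<psi> \<circ> g \<circ> the_inv_into U \<phi>) holomorphic_on M"
      using \<open>open M\<close> by blast
  qed
  ultimately show ?thesis by (auto simp: holomorphic_map_def)
qed

lemma Hol_self_map: "f \<in> Hol X A X A \<Longrightarrow> f \<in> X \<rightarrow> X"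
  by (auto simp: Hol_def)

lemma Hol_lift:
  assumes f: "f \<in> Hol X A X A" and a: "cmod a < 1" and c: "cmod c < 1" "p c = f (p a)"
  obtains F where "disc_map F" "F a = c" "\<And>z. cmod z < 1 \<Longrightarrow> p (F z) = f (p z)"
proof -
  have "holomorphic_map X A X A f" using f by (simp add: Hol_def)
  then have "holomorphic_map unit_disc disc_atlas X A (f \<circ> p)" by (rule holomorphic_map_comp_p)
  then show thesis using disc_lift[of "f \<circ> p" a c] a c that by auto
qed

lemma p_tendsto:
  assumes "(u \<longlongrightarrow> z) \<F>" "cmod z < 1" shows "((\<lambda>n. p (u n)) \<longlongrightarrow> p z) \<F>"
proof -
  have "isCont p z" using p_cont assms(2) by (simp add: continuous_on_eq_continuous_at)
  then show ?thesis using assms(1) by (rule isCont_tendsto_compose)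
qed

text \<open>
  The sets \<open>p ` ball 0 \<rho>\<close> form an increasing open exhaustion of the surface.
\<close>

lemma compact_subset_p_ball:
  assumes "compact K" "K \<subseteq> X"
  obtains \<rho> where "0 < \<rho>" "\<rho> < 1" "K \<subseteq> p ` ball 0 \<rho>"
proof -
  define O' where "O' \<rho> = K \<inter> p ` ball 0 \<rho>" for \<rho>
  have "openin (top_of_set K) (O' \<rho>)" if "\<rho> < 1" for \<rho>
  proof -
    have "openin (top_of_set X) (p ` ball 0 \<rho>)" using that by (intro open_image) auto
    then obtain S where S: "open S" "p ` ball 0 \<rho> = X \<inter> S" by (auto simp: openin_open)
    then have "O' \<rho> = K \<inter> S" using assms(2) by (auto simp: O'_def)
    then show ?thesis using S(1) by (auto simp: openin_open)
  qed
  moreover have "K \<subseteq> \<Union> (O' ` {0<..<1})"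
  proof
    fix x assume x: "x \<in> K"
    then obtain z where z: "cmod z < 1" "p z = x" using assms(2) point_over by blast
    obtain \<rho> where "cmod z < \<rho>" "\<rho> < 1" using z(1) dense by blast
    then show "x \<in> \<Union> (O' ` {0<..<1})"
      using x z by (auto simp: O'_def intro!: bexI[of _ \<rho>] order.strict_trans1[OF norm_ge_zero])
  qed
  ultimately have "\<exists>D\<subseteq>O' ` {0<..<1}. finite D \<and> K \<subseteq> \<Union> D"
    using assms(1)[unfolded compact_eq_openin_cover, rule_format, of "O' ` {0<..<1}"] by auto
  then obtain D where D: "D \<subseteq> O' ` {0<..<1}" "finite D" "K \<subseteq> \<Union> D" by blast
  then obtain R where R: "R \<subseteq> {0<..<1}" "finite R" "D = O' ` R"
    using finite_subset_image by metis
  define \<rho> where "\<rho> = Max (insert (1/2) R)"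
  have "\<rho> \<in> insert (1/2) R" unfolding \<rho>_def using R(2) by (intro Max_in) auto
  then have "0 < \<rho>" "\<rho> < 1" using R(1) by auto
  moreover have "K \<subseteq> p ` ball 0 \<rho>"
  proof
    fix x assume "x \<in> K"
    then obtain r where "r \<in> R" "x \<in> O' r" using D(3) R(3) by auto
    moreover have "r \<le> \<rho>" unfolding \<rho>_def using R(2) \<open>r \<in> R\<close> by (intro Max_ge) auto
    ultimately show "x \<in> p ` ball 0 \<rho>" by (auto simp: O'_def)
  qed
  ultimately show thesis using that by blast
qed

text \<open>
  If \<open>g\<close> were constant, \<open>G\<close> would map into one fibre of \<open>p\<close>, which is discrete, so \<open>G\<close> would be locally
  constant and its derivative would vanish.
\<close>

lemma nonconstant_of_distortion_pos:
  assumes G: "disc_map G" "\<And>z. cmod z < 1 \<Longrightarrow> p (G z) = g (p z)" and a: "cmod a < 1" "disc_distortion G a \<noteq> 0"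
  shows "\<not> g constant_on X"
proof
  assume "g constant_on X"
  then obtain k where k: "\<And>x. x \<in> X \<Longrightarrow> g x = k" by (auto simp: constant_on_def)
  have Ga: "cmod (G a) < 1" using G(1) a(1) by (rule disc_map_in)
  obtain T W q where T: "G a \<in> T" "openin (top_of_set unit_disc) T" "homeomorphism T W p q"
    using covering_space_local_homeomorphism[OF cov, of "G a"] Ga by (metis mem_ball_0)
  have inj: "inj_on p T" using T(3) by (metis homeomorphism_apply1 inj_on_inverseI)
  have "open T" using T(2) by (auto simp: openin_open_eq)
  have "continuous_on unit_disc G" using G(1) by (simp add: disc_map_def holomorphic_on_imp_continuous_on)
  then have oM: "open (unit_disc \<inter> G -` T)" using \<open>open T\<close> by (intro continuous_open_preimage) auto
  have const: "G z = G a" if "z \<in> unit_disc \<inter> G -` T" for z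
  proof -
    have "p (G z) = p (G a)" using that G(2) a(1) k p_in by simp
    then show ?thesis using inj that T(1) by (auto simp: inj_on_def)
  qed
  have aM: "a \<in> unit_disc \<inter> G -` T" using a(1) T(1) by simp
  have "((\<lambda>_. G a) has_field_derivative deriv G a) (at a)"
    using has_field_derivative_transform_within_open[OF disc_map_deriv[OF G(1) a(1)] oM aM const] .
  then have "deriv G a = 0" using DERIV_unique[OF _ DERIV_const] by blast
  then show False using a disc_distortion_eq_0_iff[OF G(1) a(1)] by simp
qed

end

section \<open>Hyperbolic distance and distortion through the covering\<close>

text \<open>
  The hyperbolic distance is defined through one chosen covering, and \<open>p\<close> is that choice.
\<close>

locale hyperbolic_covering = disc_covered_surface +
  assumes p_def: "p = (SOME p. disc_covering X A p)"
begin

lemma hyp_dist_eq: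
  "hyp_dist X A z w = Inf {disc_dist a b | a b. a \<in> unit_disc \<and> b \<in> unit_disc \<and> p a = z \<and> p b = w}"
  by (simp add: hyp_dist_def Let_def flip: p_def)

text \<open>
  Any pair \<open>a', b'\<close> over \<open>p a, p b\<close> can be moved by a lift \<open>\<gamma>\<close> of \<open>p\<close> through itself so that \<open>a'\<close> goes to \<open>a\<close>,
  and \<open>\<gamma>\<close> does not increase distances. If \<open>\<gamma> b'\<close> were closer to \<open>a\<close> than \<open>b\<close> is, both would lie in a
  neighbourhood of \<open>a\<close> on which \<open>p\<close> is injective, hence coincide.
\<close>

lemma hyp_dist_locally_disc_dist:
  assumes a: "cmod a < 1"
  shows "\<forall>\<^sub>F b in nhds a. hyp_dist X A (p a) (p b) = disc_dist a b"
proof -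
  obtain T W q where T: "a \<in> T" "openin (top_of_set unit_disc) T" "homeomorphism T W p q"
    using covering_space_local_homeomorphism[OF cov, of a] a by (metis mem_ball_0)
  have inj: "inj_on p T" using T(3) by (metis homeomorphism_apply1 inj_on_inverseI)
  have "open T" using T(2) by (auto simp: openin_open_eq)
  then obtain e0 where e0: "e0 > 0" "ball a e0 \<subseteq> T" using T(1) openE by blast
  \<comment> \<open>hyperbolic radius \<open>artanh \<epsilon>\<close> around \<open>a\<close> stays inside the Euclidean ball of radius \<open>2 \<epsilon>\<close>\<close>
  define \<epsilon> where "\<epsilon> = min (e0 / 2) (1 / 2)"
  have \<epsilon>: "0 < \<epsilon>" "\<epsilon> < 1" "2 * \<epsilon> \<le> e0" using e0 by (auto simp: \<epsilon>_def)
  have nearT: "b \<in> T" if "cmod b < 1" "disc_dist a b < artanh \<epsilon>" for b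
    using dist_le_of_disc_dist[OF a that(1) \<epsilon>(1,2) that(2)] \<epsilon>(3) e0(2) by auto
  have eq: "hyp_dist X A (p a) (p b) = disc_dist a b" if b: "cmod b < 1" "disc_dist a b < artanh \<epsilon>" for b
    unfolding hyp_dist_eq
  proof (rule cInf_eq_minimum)
    show "disc_dist a b \<in> {disc_dist a' b' | a' b'. a' \<in> unit_disc \<and> b' \<in> unit_disc \<and> p a' = p a \<and> p b' = p b}"
      using a b by auto
    fix x assume "x \<in> {disc_dist a' b' | a' b'. a' \<in> unit_disc \<and> b' \<in> unit_disc \<and> p a' = p a \<and> p b' = p b}"
    then obtain a' b' where x: "x = disc_dist a' b'" "cmod a' < 1" "cmod b' < 1" "p a' = p a" "p b' = p b"
      by auto
    obtain \<gamma> where \<gamma>: "disc_map \<gamma>" "\<gamma> a' = a" "\<And>z. cmod z < 1 \<Longrightarrow> p (\<gamma> z) = p z"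
      using disc_lift[OF p_holomorphic_map x(2) a] x(4) by metis
    have le: "disc_dist a (\<gamma> b') \<le> x"
      using disc_dist_contraction[OF \<gamma>(1) x(2,3)] \<gamma>(2) x(1) by simp
    show "disc_dist a b \<le> x"
    proof (rule ccontr)
      assume "\<not> disc_dist a b \<le> x"
      then have "disc_dist a (\<gamma> b') < artanh \<epsilon>" using le b by linarith
      then have "\<gamma> b' \<in> T" using nearT disc_map_in[OF \<gamma>(1) x(3)] by blast
      moreover have "b \<in> T" using nearT b by blast
      moreover have "p (\<gamma> b') = p b" using \<gamma>(3) x by simp
      ultimately have "\<gamma> b' = b" using inj by (simp add: inj_on_eq_iff)
      then show False using le \<open>\<not> disc_dist a b \<le> x\<close> by simp
    qed
  qed
  have "1 - cnj a * a \<noteq> 0" using mob_denominator_nonzero[OF a a] .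
  then have "((\<lambda>b. mob a b) \<longlongrightarrow> (a - a) / (1 - cnj a * a)) (nhds a)"
    unfolding Moebius_function_simple by (intro tendsto_intros filterlim_ident)
  then have "((\<lambda>b. cmod (mob a b)) \<longlongrightarrow> 0) (nhds a)"
    using tendsto_norm by fastforce
  then have "((\<lambda>b. artanh (cmod (mob a b))) \<longlongrightarrow> artanh 0) (nhds a)"
    by (intro tendsto_artanh) auto
  then have "((\<lambda>b. disc_dist a b) \<longlongrightarrow> 0) (nhds a)"
    by (simp add: disc_dist_eq_artanh_mob)
  moreover have "0 < artanh \<epsilon>" using artanh_real_strict_mono[of 0 \<epsilon>] \<epsilon> by simp
  ultimately have "\<forall>\<^sub>F b in nhds a. disc_dist a b < artanh \<epsilon>" by (rule order_tendstoD)
  moreover have "\<forall>\<^sub>F b in nhds a. b \<in> unit_disc"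
    using a by (intro eventually_nhds_in_open) auto
  ultimately show ?thesis by eventually_elim (use eq in auto)
qed

lemma hyp_distortion_eq_disc_distortion:
  assumes F: "disc_map F" "\<And>z. cmod z < 1 \<Longrightarrow> p (F z) = f (p z)" and a: "cmod a < 1"
  shows "hyp_distortion X A f (p a) = disc_distortion F a"
proof -
  define Q where "Q b = hyp_dist X A (p (F a)) (p (F b)) / hyp_dist X A (p a) (p b)" for b
  have Fa: "cmod (F a) < 1" using F(1) a by (rule disc_map_in)
  have "F \<midarrow>a\<rightarrow> F a" using disc_map_deriv[OF F(1) a] DERIV_isCont isCont_def by blast
  then have ev1: "\<forall>\<^sub>F b in at a. hyp_dist X A (p (F a)) (p (F b)) = disc_dist (F a) (F b)"
    using eventually_compose_filterlim[OF hyp_dist_locally_disc_dist[OF Fa]] by blast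
  have ev2: "\<forall>\<^sub>F b in at a. hyp_dist X A (p a) (p b) = disc_dist a b"
    using hyp_dist_locally_disc_dist[OF a] unfolding eventually_at_filter
    by (rule eventually_mono) simp
  have Q: "(Q \<longlongrightarrow> disc_distortion F a) (at a)"
    using tendsto_disc_dist_quotient[OF F(1) a]
    by (rule Lim_transform_eventually) (use ev1 ev2 in eventually_elim, simp add: Q_def)
  obtain T W q where T: "a \<in> T" "openin (top_of_set unit_disc) T" "p a \<in> W" "openin (top_of_set X) W"
    "homeomorphism T W p q"
    using covering_space_local_homeomorphism[OF cov, of a] a by (metis mem_ball_0)
  have inj: "inj_on p T" using T(5) by (metis homeomorphism_apply1 inj_on_inverseI)
  have oT: "open T" "T \<subseteq> unit_disc" using T(2) by (auto simp: openin_open_eq)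
  have q: "q (p a) = a" "continuous_on W q" "\<And>w. w \<in> W \<Longrightarrow> q w \<in> T" "\<And>w. w \<in> W \<Longrightarrow> p (q w) = w"
    using T by (auto simp: homeomorphism_def)
  obtain S where S: "open S" "W = X \<inter> S" using T(4) by (auto simp: openin_open)
  have at: "at (p a) within X = at (p a) within W"
    by (rule at_within_nhd[of _ S]) (use S T(3) in auto)
  have inW: "\<forall>\<^sub>F w in at (p a) within X. w \<in> W \<and> w \<noteq> p a"
    unfolding at by (simp add: eventually_at_filter)
  have "(q \<longlongrightarrow> a) (at (p a) within X)"
    using q(1,2) T(3) unfolding at continuous_on_def by metis
  moreover have "\<forall>\<^sub>F w in at (p a) within X. q w \<noteq> a"
    using inW by eventually_elim (use q in metis)
  ultimately have q_at: "filterlim q (at a) (at (p a) within X)"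
    by (simp add: filterlim_at)
  have "((\<lambda>w. Q (q w)) \<longlongrightarrow> disc_distortion F a) (at (p a) within X)"
    using Q q_at by (rule filterlim_compose)
  then have "((\<lambda>w. hyp_dist X A (f (p a)) (f w) / hyp_dist X A (p a) w) \<longlongrightarrow> disc_distortion F a)
      (at (p a) within X)"
  proof (rule Lim_transform_eventually)
    show "\<forall>\<^sub>F w in at (p a) within X. Q (q w) = hyp_dist X A (f (p a)) (f w) / hyp_dist X A (p a) w"
      using inW
    proof eventually_elim
      case (elim w)
      then have "cmod (q w) < 1" using q(3)[of w] oT(2) by auto
      then show ?case using q(4)[of w] elim F(2) a by (simp add: Q_def)
    qed
  qed
  \<comment> \<open>the limit defining the distortion is over a nontrivial filter: \<open>p a\<close> is not isolated\<close>
  moreover have "at (p a) within X \<noteq> bot"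
  proof
    assume bot: "at (p a) within X = bot"
    have "(p \<longlongrightarrow> p a) (at a)"
      using p_cont a by (simp add: continuous_on_eq_continuous_at isCont_def)
    moreover have "\<forall>\<^sub>F b in at a. b \<in> T \<and> b \<noteq> a"
      using oT(1) T(1) eventually_at_in_open[of T a] by (auto elim: eventually_mono)
    then have "\<forall>\<^sub>F b in at a. p b \<in> X \<and> p b \<noteq> p a"
    proof eventually_elim
      case (elim b)
      then show ?case using inj T(1) oT(2) p_in[of b] by (auto simp: inj_on_eq_iff)
    qed
    ultimately have "filterlim p (at (p a) within X) (at a)"
      by (auto simp: filterlim_at)
    then have "\<forall>\<^sub>F b in at a. False"
      unfolding bot filterlim_iff by (auto dest: spec[of _ "\<lambda>_. False"])
    then show False by simp
  qed
  ultimately show ?thesis unfolding hyp_distortion_def by (intro tendsto_Lim)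
qed

end

section \<open>The compact-open topology\<close>

lemma topspace_compact_open: "topspace (compact_open_topology X Y F) = F"
proof -
  have "F \<in> {{f \<in> F. f ` K \<subseteq> U} | K U. compact K \<and> K \<subseteq> X \<and> openin (top_of_set Y) U}"
    by (rule CollectI, rule exI[of _ "{}"], rule exI[of _ "{}"]) auto
  then show ?thesis unfolding compact_open_topology_def topology_generated_by_topspace by auto
qed

lemma openin_compact_open:
  assumes "compact K" "K \<subseteq> X" "openin (top_of_set Y) U"
  shows "openin (compact_open_topology X Y F) {f \<in> F. f ` K \<subseteq> U}"
  unfolding compact_open_topology_def
  by (rule topology_generated_by_Basis) (use assms in blast)

lemma limitin_compact_openI:
  assumes "g \<in> F"
    and "\<And>K U. \<lbrakk>compact K; K \<subseteq> X; openin (top_of_set Y) U; g ` K \<subseteq> U\<rbrakk>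
      \<Longrightarrow> \<forall>\<^sub>F n in \<F>. s n \<in> F \<and> s n ` K \<subseteq> U"
  shows "limitin (compact_open_topology X Y F) s g \<F>"
  unfolding limitin_def topspace_compact_open
proof (intro conjI allI impI)
  show "g \<in> F" by fact
  fix O' assume O: "openin (compact_open_topology X Y F) O' \<and> g \<in> O'"
  then have "generate_topology_on {{f \<in> F. f ` K \<subseteq> U} | K U. compact K \<and> K \<subseteq> X \<and> openin (top_of_set Y) U} O'"
    unfolding compact_open_topology_def by (auto intro: openin_topology_generated_by)
  then have "g \<in> O' \<longrightarrow> (\<forall>\<^sub>F n in \<F>. s n \<in> O')"
  proof induction
    case Empty then show ?case by simp
  next
    case (Int a b) then show ?case by (auto intro: eventually_conj)
  next
    case (UN K)
    show ?case
    proof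
      assume "g \<in> \<Union>K"
      then obtain k where k: "k \<in> K" "g \<in> k" by blast
      then have "\<forall>\<^sub>F n in \<F>. s n \<in> k" using UN.IH by blast
      then show "\<forall>\<^sub>F n in \<F>. s n \<in> \<Union>K" by eventually_elim (use k in blast)
    qed
  next
    case (Basis t) then show ?case using assms(2) by auto
  qed
  then show "\<forall>\<^sub>F n in \<F>. s n \<in> O'" using O by blast
qed

lemma limitin_compact_open_pointwise:
  assumes lim: "limitin (compact_open_topology X Y F) s g \<F>" and x: "x \<in> X"
    and F: "\<And>f. f \<in> F \<Longrightarrow> f \<in> X \<rightarrow> Y"
  shows "((\<lambda>n. s n x) \<longlongrightarrow> g x) \<F>"
proof (rule topological_tendstoI)
  fix S assume S: "open S" "g x \<in> S"
  have g: "g \<in> F" using lim topspace_compact_open by (metis limitin_topspace)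
  have "openin (compact_open_topology X Y F) {f \<in> F. f ` {x} \<subseteq> Y \<inter> S}"
    using x S by (intro openin_compact_open) auto
  moreover have "g \<in> {f \<in> F. f ` {x} \<subseteq> Y \<inter> S}" using g F x S by auto
  ultimately have "\<forall>\<^sub>F n in \<F>. s n \<in> {f \<in> F. f ` {x} \<subseteq> Y \<inter> S}"
    using lim unfolding limitin_def by blast
  then show "\<forall>\<^sub>F n in \<F>. s n x \<in> S" by eventually_elim auto
qed

text \<open>
  Evaluation at a point is continuous, so it maps the compact closure to a compact set.
\<close>

lemma relatively_compact_evaluation:
  assumes rc: "relatively_compactin (compact_open_topology X Y F) S" and x: "x \<in> X"
    and F: "\<And>f. f \<in> F \<Longrightarrow> f \<in> X \<rightarrow> Y"
  shows "\<exists>K. compact K \<and> K \<subseteq> Y \<and> (\<forall>f\<in>S. f x \<in> K)"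
proof -
  let ?T = "compact_open_topology X Y F"
  define K where "K = (\<lambda>f. f x) ` (?T closure_of S)"
  have "continuous_map ?T (top_of_set Y) (\<lambda>f. f x)"
    unfolding continuous_map
  proof (intro conjI allI impI)
    show "(\<lambda>f. f x) ` topspace ?T \<subseteq> topspace (top_of_set Y)"
      using F x by (auto simp: topspace_compact_open)
    fix U assume "openin (top_of_set Y) U"
    then have "openin ?T {f \<in> F. f ` {x} \<subseteq> U}" using x by (intro openin_compact_open) auto
    then show "openin ?T {f \<in> topspace ?T. f x \<in> U}" by (simp add: topspace_compact_open)
  qed
  then have "compactin (top_of_set Y) K"
    unfolding K_def using rc by (intro image_compactin) (auto simp: relatively_compactin_def)
  then have "compact K" "K \<subseteq> Y" by (auto simp: compactin_subtopology)
  moreover have "f x \<in> K" if "f \<in> S" for f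
    using rc that closure_of_subset[of S ?T] by (auto simp: K_def relatively_compactin_def)
  ultimately show ?thesis by blast
qed

section \<open>Convergence of maps and of their lifts\<close>

context disc_covered_surface
begin

text \<open>
  The lifts are normalized at \<open>a\<close>: for large \<open>n\<close> their value there is the point near \<open>c\<close> over \<open>g n (p a)\<close>. This
  prevents them from escaping to the boundary, since a limit of self-maps of the disc which takes a
  value inside the disc is a self-map of the disc.
\<close>

lemma lifts_convergent_subsequence:
  assumes g: "\<And>n. g n \<in> Hol X A X A" and a: "cmod a < 1" and c: "cmod c < 1"
    and lim: "(\<lambda>n. g n (p a)) \<longlonglongrightarrow> p c"
  obtains r :: "nat \<Rightarrow> nat" and \<Phi> G where "strict_mono r" "\<And>n. disc_map (\<Phi> n)"
    "\<And>n z. cmod z < 1 \<Longrightarrow> p (\<Phi> n z) = g (r n) (p z)" "disc_map G"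
    "\<And>K. \<lbrakk>compact K; K \<subseteq> unit_disc\<rbrakk> \<Longrightarrow> uniform_limit K \<Phi> G sequentially"
proof -
  obtain T W q where T: "c \<in> T" "openin (top_of_set unit_disc) T" "p c \<in> W" "openin (top_of_set X) W"
    "homeomorphism T W p q"
    using covering_space_local_homeomorphism[OF cov, of c] c by (metis mem_ball_0)
  have TD: "T \<subseteq> unit_disc" using T(2) by (auto simp: openin_open_eq)
  have q: "q (p c) = c" "continuous_on W q" "\<And>w. w \<in> W \<Longrightarrow> q w \<in> T" "\<And>w. w \<in> W \<Longrightarrow> p (q w) = w"
    using T by (auto simp: homeomorphism_def)
  have gX: "g n (p a) \<in> X" for n using Hol_self_map[OF g] p_in[OF a] by auto
  obtain S where S: "open S" "W = X \<inter> S" using T(4) by (auto simp: openin_open)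
  have inW: "\<forall>\<^sub>F n in sequentially. g n (p a) \<in> W"
    using topological_tendstoD[OF lim S(1)] T(3) S(2) gX by auto
  \<comment> \<open>only finitely many \<open>n\<close> fall under the second case\<close>
  define c' where "c' n = (if g n (p a) \<in> W then q (g n (p a)) else (SOME z. cmod z < 1 \<and> p z = g n (p a)))" for n
  have c': "cmod (c' n) < 1 \<and> p (c' n) = g n (p a)" for n
  proof (cases "g n (p a) \<in> W")
    case True
    then have "q (g n (p a)) \<in> unit_disc" using q(3) TD by blast
    then show ?thesis using True q(4) by (simp add: c'_def)
  next
    case False then show ?thesis using someI_ex[OF point_over[OF gX]] by (simp add: c'_def)
  qed
  have "(\<lambda>n. q (g n (p a))) \<longlonglongrightarrow> q (p c)"
    using continuous_on_tendsto_compose[OF q(2) lim T(3) inW] .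
  then have c'_lim: "c' \<longlonglongrightarrow> c"
    unfolding q(1) by (rule Lim_transform_eventually) (use inW in eventually_elim, simp add: c'_def)
  have "\<exists>F. disc_map F \<and> F a = c' n \<and> (\<forall>z. cmod z < 1 \<longrightarrow> p (F z) = g n (p z))" for n
    using Hol_lift[OF g[of n] a, of "c' n"] c' by metis
  then obtain \<Psi> where \<Psi>: "\<And>n. disc_map (\<Psi> n)" "\<And>n. \<Psi> n a = c' n"
    "\<And>n z. cmod z < 1 \<Longrightarrow> p (\<Psi> n z) = g n (p z)" by metis
  obtain G r where G: "G holomorphic_on unit_disc" "strict_mono (r :: nat \<Rightarrow> nat)"
    "\<And>x. x \<in> unit_disc \<Longrightarrow> ((\<lambda>n. \<Psi> (r n) x) \<longlongrightarrow> G x) sequentially"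
    "\<And>K. \<lbrakk>compact K; K \<subseteq> unit_disc\<rbrakk> \<Longrightarrow> uniform_limit K (\<Psi> \<circ> r) G sequentially"
  proof (rule Montel[of unit_disc "range \<Psi>" \<Psi>])
    show "\<exists>B. \<forall>h\<in>range \<Psi>. \<forall>z\<in>K. cmod (h z) \<le> B" if KD: "K \<subseteq> unit_disc" for K
    proof (intro exI[of _ 1] ballI)
      fix h z assume "h \<in> range \<Psi>" "z \<in> K"
      then obtain n where "h = \<Psi> n" "cmod z < 1" using KD by auto
      then show "cmod (h z) \<le> 1" using disc_map_in[OF \<Psi>(1)[of n], of z] by simp
    qed
  qed (use \<Psi>(1) in \<open>auto simp: disc_map_def\<close>)
  have "(\<lambda>n. c' (r n)) \<longlonglongrightarrow> c" using LIMSEQ_subseq_LIMSEQ[OF c'_lim G(2)] by (simp add: o_def)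
  then have Ga: "G a = c" using G(3)[of a] a \<Psi>(2) LIMSEQ_unique by auto
  have G1: "cmod (G z) \<le> 1" if "cmod z < 1" for z
  proof (rule tendsto_upperbound)
    show "(\<lambda>n. cmod (\<Psi> (r n) z)) \<longlonglongrightarrow> cmod (G z)" using G(3)[of z] that by (auto intro: tendsto_norm)
    show "\<forall>\<^sub>F n in sequentially. cmod (\<Psi> (r n) z) \<le> 1"
      using disc_map_in[OF \<Psi>(1) that] by (intro always_eventually allI less_imp_le)
  qed auto
  have "cmod (G z) < 1" if z: "cmod z < 1" for z
  proof (rule ccontr)
    assume "\<not> cmod (G z) < 1"
    then have z1: "cmod (G z) = 1" using G1[OF z] by simp
    then have "G constant_on unit_disc"
      using z G1 by (intro maximum_modulus_principle[OF G(1), of unit_disc z]) auto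
    then have "G a = G z" using a z by (auto simp: constant_on_def)
    then show False using Ga c z1 by simp
  qed
  then have "disc_map G" using G(1) by (auto simp: disc_map_def)
  then show thesis
    using that[of r "\<Psi> \<circ> r" G] G \<Psi> by (simp add: o_def)
qed

text \<open>
  Every compact set of the surface is the image of a compact set of the disc, on which the lifts
  converge uniformly.
\<close>

lemma limitin_Hol_of_lifts:
  assumes s: "\<And>n. s n \<in> Hol X A X A" and g: "g \<in> Hol X A X A"
    and lift: "\<And>n. disc_map (\<Phi> n)" "\<And>n z. cmod z < 1 \<Longrightarrow> p (\<Phi> n z) = s n (p z)"
    and G: "disc_map G" "\<And>z. cmod z < 1 \<Longrightarrow> g (p z) = p (G z)"
    and lim: "\<And>K. \<lbrakk>compact K; K \<subseteq> unit_disc\<rbrakk> \<Longrightarrow> uniform_limit K \<Phi> G sequentially"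
  shows "limitin (Hol_topology X A) s g sequentially"
proof (rule limitin_compact_openI[OF g])
  fix K U assume K: "compact K" "K \<subseteq> X" and U: "openin (top_of_set X) U" and gK: "g ` K \<subseteq> U"
  obtain \<rho> where \<rho>: "\<rho> < 1" "K \<subseteq> p ` ball 0 \<rho>" using compact_subset_p_ball[OF K] by metis
  define K' where "K' = cball 0 \<rho> \<inter> p -` K"
  have "continuous_on (cball 0 \<rho>) p"
    using p_cont by (rule continuous_on_subset) (use \<rho> in auto)
  then have "closedin (top_of_set (cball 0 \<rho>)) K'"
    unfolding K'_def using K(1) by (intro continuous_closedin_preimage compact_imp_closed)
  then have K': "compact K'" by (rule closedin_compact[OF compact_cball])
  have K'D: "K' \<subseteq> unit_disc" using \<rho>(1) by (auto simp: K'_def)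
  have contG: "continuous_on K' G"
    using G(1) K'D by (auto simp: disc_map_def intro: holomorphic_on_imp_continuous_on holomorphic_on_subset)
  define V where "V = unit_disc \<inter> p -` U"
  have "open V" unfolding V_def using p_cont U p_in by (intro open_vimage) auto
  moreover have "G ` K' \<subseteq> V"
  proof
    fix w assume "w \<in> G ` K'"
    then obtain z where z: "w = G z" "z \<in> K'" by blast
    then have "cmod z < 1" "p z \<in> K" using K'D by (auto simp: K'_def)
    then show "w \<in> V" using gK G z disc_map_in[OF G(1)] by (auto simp: V_def)
  qed
  ultimately obtain \<epsilon> where \<epsilon>: "\<epsilon> > 0" "(\<Union>x\<in>G ` K'. ball x \<epsilon>) \<subseteq> V"
    using compact_subset_open_imp_ball_epsilon_subset compact_continuous_image[OF contG K'] by metis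
  have "\<forall>\<^sub>F n in sequentially. \<forall>z\<in>K'. dist (\<Phi> n z) (G z) < \<epsilon>"
    using lim[OF K' K'D] \<epsilon>(1) by (rule uniform_limitD)
  then show "\<forall>\<^sub>F n in sequentially. s n \<in> Hol X A X A \<and> s n ` K \<subseteq> U"
  proof eventually_elim
    case (elim n)
    have "s n x \<in> U" if x: "x \<in> K" for x
    proof -
      obtain z where z: "z \<in> ball 0 \<rho>" "x = p z" using x \<rho>(2) by blast
      then have "z \<in> K'" "cmod z < 1" using x \<rho>(1) by (auto simp: K'_def)
      then have "\<Phi> n z \<in> ball (G z) \<epsilon>" using elim by (simp add: dist_commute)
      then have "\<Phi> n z \<in> V" using \<epsilon>(2) \<open>z \<in> K'\<close> by blast
      then show ?thesis using lift(2)[OF \<open>cmod z < 1\<close>] z(2) by (simp add: V_def)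
    qed
    then show ?case using s by blast
  qed
qed

end

section \<open>Infinite products of factors in the unit interval\<close>

text \<open>
  The terms satisfy \<open>1 - q n = (\<mu> n - \<mu> (n+1)) / \<mu> n\<close>, and \<open>\<mu> n \<ge> l\<close>, so the telescoping series of \<open>\<mu>\<close>
  divided by \<open>l\<close> is a majorant.
\<close>

lemma summable_of_product_limit_pos:
  fixes q \<mu> :: "nat \<Rightarrow> real"
  assumes "\<mu> 0 = 1" "\<And>n. \<mu> (Suc n) = q n * \<mu> n" "\<And>n. 0 \<le> q n" "\<And>n. q n \<le> 1"
    and lim: "\<mu> \<longlonglongrightarrow> l" "l > 0"
  shows "summable (\<lambda>n. 1 - q n)"
proof (rule summable_comparison_test')
  have nonneg: "0 \<le> \<mu> n" for n by (induction n) (use assms in auto)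
  have "decseq \<mu>" unfolding decseq_Suc_iff using assms nonneg by (auto intro: mult_left_le_one_le)
  then have l: "l \<le> \<mu> n" for n using lim(1) by (rule decseq_ge)
  have "summable (\<lambda>n. \<mu> n - \<mu> (Suc n))" by (rule telescope_summable'[OF lim(1)])
  then show "summable (\<lambda>n. (\<mu> n - \<mu> (Suc n)) / l)" by (rule summable_divide)
  fix n
  have "(1 - q n) * l \<le> (1 - q n) * \<mu> n" using l assms by (intro mult_left_mono) auto
  also have "\<dots> = \<mu> n - \<mu> (Suc n)" by (simp add: assms(2) algebra_simps)
  finally show "norm (1 - q n) \<le> (\<mu> n - \<mu> (Suc n)) / l"
    using lim(2) assms(4)[of n] by (simp add: pos_le_divide_eq)
qed

lemma product_limit_pos_of_summable:
  fixes q \<mu> :: "nat \<Rightarrow> real"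
  assumes "\<mu> 0 = 1" "\<And>n. \<mu> (Suc n) = q n * \<mu> n" "\<And>n. 0 < q n" "\<And>n. q n \<le> 1"
    and sum: "summable (\<lambda>n. 1 - q n)"
  obtains l where "\<mu> \<longlonglongrightarrow> l" "l > 0"
proof -
  have \<mu>: "\<mu> n = (\<Prod>i<n. q i)" for n by (induction n) (use assms in \<open>auto simp: mult.commute\<close>)
  have "norm (q n - 1) = 1 - q n" for n using assms(4)[of n] by simp
  then have "summable (\<lambda>n. norm (q n - 1))" using sum by simp
  then have "abs_convergent_prod q" by (simp add: abs_convergent_prod_conv_summable)
  then have conv: "convergent_prod q" by (rule abs_convergent_prod_imp_convergent_prod)
  then have "(\<lambda>n. \<Prod>i\<le>n. q i) \<longlonglongrightarrow> prodinf q" by (rule convergent_prod_LIMSEQ)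
  then have "(\<lambda>n. \<mu> (Suc n)) \<longlonglongrightarrow> prodinf q" by (simp add: \<mu> lessThan_Suc_atMost)
  then have 1: "\<mu> \<longlonglongrightarrow> prodinf q" by (simp add: filterlim_sequentially_Suc)
  have "prodinf q \<noteq> 0" using conv assms(3) by (intro prodinf_nonzero) (auto simp: less_le)
  moreover have "0 \<le> prodinf q"
    using 1 by (rule LIMSEQ_le_const) (auto simp: \<mu> intro!: prod_nonneg less_imp_le[OF assms(3)])
  ultimately show thesis using that 1 by simp
qed

section \<open>Left iterated function systems\<close>

locale left_iteration = hyperbolic_covering X A p
  for X :: "'a::t2_space set" and A :: "'a chart set" and p :: "complex \<Rightarrow> 'a" +
  fixes f L :: "nat \<Rightarrow> 'a \<Rightarrow> 'a"
  assumes f_Hol: "\<And>n. n \<ge> 1 \<Longrightarrow> f n \<in> Hol X A X A"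
    and L_def: "\<And>n. L n = left_comp X f n"
    and L_relcompact: "relatively_compactin (Hol_topology X A) {L n | n. n \<ge> 1}"
begin

lemma L_Suc_Hol: "L (Suc n) \<in> Hol X A X A"
proof -
  have "L (Suc n) \<in> {L n | n. n \<ge> 1}" by auto
  then show ?thesis using L_relcompact by (auto simp: relatively_compactin_def topspace_compact_open)
qed

lemma L_in: "x \<in> X \<Longrightarrow> L n x \<in> X"
  using Hol_self_map[OF L_Suc_Hol] by (cases n) (auto simp: L_def[of 0])

lemma L_rec: "x \<in> X \<Longrightarrow> L (Suc n) x = f (Suc n) (L n x)"
  by (simp add: L_def compose_def)

definition F :: "nat \<Rightarrow> complex \<Rightarrow> complex" where
  "F n = (SOME F. disc_map F \<and> (\<forall>z. cmod z < 1 \<longrightarrow> p (F z) = f n (p z)))"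

lemma F_lifts_f:
  assumes "n \<ge> 1"
  shows "disc_map (F n)" "\<And>z. cmod z < 1 \<Longrightarrow> p (F n z) = f n (p z)"
proof -
  have "f n (p 0) \<in> X" using Hol_self_map[OF f_Hol[OF assms]] p_in[of 0] by auto
  then obtain c where "cmod c < 1" "p c = f n (p 0)" using point_over by blast
  then have "\<exists>F. disc_map F \<and> (\<forall>z. cmod z < 1 \<longrightarrow> p (F z) = f n (p z))"
    using Hol_lift[OF f_Hol[OF assms], of 0 c] by (metis norm_zero zero_less_one)
  from someI_ex[OF this, folded F_def]
  show "disc_map (F n)" "\<And>z. cmod z < 1 \<Longrightarrow> p (F n z) = f n (p z)" by auto
qed

text \<open>
  The composites of the chosen lifts. They lift the \<open>L n\<close>, but they need not converge along a
  subsequence on which \<open>L n\<close> converges: convergent lifts have to be chosen afresh. As the distortion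
  depends only on \<open>L n\<close>, both families have the same distortions.
\<close>

primrec \<Lambda> :: "nat \<Rightarrow> complex \<Rightarrow> complex" where
  "\<Lambda> 0 = id"
| "\<Lambda> (Suc n) = F (Suc n) \<circ> \<Lambda> n"

lemma \<Lambda>_lifts_L: "disc_map (\<Lambda> n)" "cmod z < 1 \<Longrightarrow> p (\<Lambda> n z) = L n (p z)"
proof -
  show 1: "disc_map (\<Lambda> n)" for n
  proof (induction n)
    case 0 show ?case by (simp add: disc_map_def)
  next
    case (Suc n)
    have "disc_map (F (Suc n))" by (rule F_lifts_f) simp
    with Suc show ?case unfolding \<Lambda>.simps by (intro disc_map_compose)
  qed
  show "p (\<Lambda> n z) = L n (p z)" if z: "cmod z < 1"
  proof (induction n)
    case 0 show ?case using p_in[OF z] by (simp add: L_def)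
  next
    case (Suc n)
    then show ?case using F_lifts_f(2)[of "Suc n" "\<Lambda> n z"] disc_map_in[OF 1 z, of n] L_rec[OF p_in[OF z]] by simp
  qed
qed

abbreviation \<mu> :: "complex \<Rightarrow> nat \<Rightarrow> real" where
  "\<mu> a n \<equiv> disc_distortion (\<Lambda> n) a"

abbreviation \<delta> :: "nat \<Rightarrow> 'a \<Rightarrow> real" where
  "\<delta> n x \<equiv> hyp_distortion X A (f (Suc n)) x"

lemma distortion_factor: "cmod z < 1 \<Longrightarrow> \<delta> n (p z) = disc_distortion (F (Suc n)) z"
  by (rule hyp_distortion_eq_disc_distortion) (use F_lifts_f[of "Suc n"] in auto)

lemma distortion_le_1: "x \<in> X \<Longrightarrow> \<delta> n x \<le> 1"
  using point_over[of x] distortion_factor Schwarz_Pick(2)[OF F_lifts_f(1)[of "Suc n"]] by auto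

lemma distortion_nonneg: "x \<in> X \<Longrightarrow> 0 \<le> \<delta> n x"
  using point_over[of x] distortion_factor disc_distortion_nonneg[OF F_lifts_f(1)[of "Suc n"]] by auto

lemma composite_distortion:
  assumes a: "cmod a < 1"
  shows "\<mu> a 0 = 1" "\<mu> a (Suc n) = \<delta> n (L n (p a)) * \<mu> a n"
proof -
  have "1 - (cmod a)\<^sup>2 \<noteq> 0" using cmod_square_less_1[OF a] by simp
  then show "\<mu> a 0 = 1" by (simp add: disc_distortion_def)
  have "cmod (\<Lambda> n a) < 1" using \<Lambda>_lifts_L(1) a by (rule disc_map_in)
  then show "\<mu> a (Suc n) = \<delta> n (L n (p a)) * \<mu> a n"
    using disc_distortion_compose[OF \<Lambda>_lifts_L(1) F_lifts_f(1) a, of "Suc n" n] distortion_factor[of "\<Lambda> n a" n]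
      \<Lambda>_lifts_L(2)[OF a, of n] by simp
qed

lemma orbit_bounded:
  assumes x: "x \<in> X"
  obtains \<rho> where "0 < \<rho>" "\<rho> < 1" "\<And>n. L n x \<in> p ` ball 0 \<rho>"
proof -
  obtain K where K: "compact K" "K \<subseteq> X" "\<And>g. g \<in> {L n | n. n \<ge> 1} \<Longrightarrow> g x \<in> K"
    using relatively_compact_evaluation[OF L_relcompact x Hol_self_map] by blast
  have "compact (insert x K)" "insert x K \<subseteq> X" using K x by (auto intro: compact_insert)
  then obtain \<rho> where \<rho>: "0 < \<rho>" "\<rho> < 1" "insert x K \<subseteq> p ` ball 0 \<rho>" by (rule compact_subset_p_ball)
  have "L n x \<in> insert x K" for n
  proof (cases n)
    case 0 then show ?thesis using x by (simp add: L_def)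
  next
    case (Suc m) then show ?thesis using K(3)[of "L n"] by auto
  qed
  then show thesis using that[of \<rho>] \<rho> by blast
qed

lemma summable_distortion_transfer:
  assumes \<rho>: "0 \<le> \<rho>" "\<rho> < 1" and x: "\<And>n. x n \<in> p ` ball 0 \<rho>" and y: "\<And>n. y n \<in> p ` ball 0 \<rho>"
    and sum: "summable (\<lambda>n. 1 - \<delta> n (x n))"
  shows "summable (\<lambda>n. 1 - \<delta> n (y n))"
proof -
  obtain M where M: "0 \<le> M" "\<And>F a b. \<lbrakk>disc_map F; cmod a \<le> \<rho>; cmod b \<le> \<rho>\<rbrakk>
      \<Longrightarrow> 1 - disc_distortion F b \<le> M * (1 - disc_distortion F a)"
    using disc_distortion_compare_uniform[OF \<rho>] by metis
  show ?thesis
  proof (rule summable_comparison_test')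
    show "summable (\<lambda>n. M * (1 - \<delta> n (x n)))" using sum by (rule summable_mult)
    fix n
    obtain a b where ab: "cmod a < \<rho>" "x n = p a" "cmod b < \<rho>" "y n = p b"
      using x[of n] y[of n] by auto
    then have "y n \<in> X" using p_in[of b] \<rho> by simp
    then have "norm (1 - \<delta> n (y n)) = 1 - \<delta> n (y n)" using distortion_le_1[of "y n" n] by simp
    also have "\<dots> \<le> M * (1 - \<delta> n (x n))"
      using M(2)[OF F_lifts_f(1)[of "Suc n"], of a b] ab \<rho> distortion_factor by simp
    finally show "norm (1 - \<delta> n (y n)) \<le> M * (1 - \<delta> n (x n))" .
  qed
qed

text \<open>
  A fixed point and the orbit of another one lie together in the image of a compact subset of the
  disc, where the distortions of all self-maps are uniformly comparable.
\<close>

lemma summable_along_orbit_iff: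
  assumes "x \<in> X" "y \<in> X"
  shows "summable (\<lambda>n. 1 - \<delta> n x) \<longleftrightarrow> summable (\<lambda>n. 1 - \<delta> n (L n y))"
proof -
  have "compact {x}" "{x} \<subseteq> X" using assms by auto
  then obtain \<rho>1 where \<rho>1: "0 < \<rho>1" "\<rho>1 < 1" "{x} \<subseteq> p ` ball 0 \<rho>1" by (rule compact_subset_p_ball)
  obtain \<rho>2 where \<rho>2: "0 < \<rho>2" "\<rho>2 < 1" "\<And>n. L n y \<in> p ` ball 0 \<rho>2"
    using orbit_bounded[OF assms(2)] by metis
  define \<rho> where "\<rho> = max \<rho>1 \<rho>2"
  have sub: "ball 0 \<rho>1 \<subseteq> ball (0::complex) \<rho>" "ball 0 \<rho>2 \<subseteq> ball (0::complex) \<rho>"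
    by (auto simp: \<rho>_def)
  have \<rho>: "0 \<le> \<rho>" "\<rho> < 1" using \<rho>1 \<rho>2 by (auto simp: \<rho>_def)
  have xy: "x \<in> p ` ball 0 \<rho>" "\<And>n. L n y \<in> p ` ball 0 \<rho>"
    using \<rho>1(3) \<rho>2(3) sub by blast+
  show ?thesis
    using summable_distortion_transfer[OF \<rho>, of "\<lambda>_. x" "\<lambda>n. L n y", OF xy]
      summable_distortion_transfer[OF \<rho>, of "\<lambda>n. L n y" "\<lambda>_. x", OF xy(2,1)] by blast
qed

text \<open>
  Lifts of the converging subsequence, normalized at one point, have a limit \<open>G\<close>, and their
  derivatives converge as well. Their distortions are those of the \<open>\<Lambda> (r n)\<close>, because both lift \<open>L (r n)\<close>.
\<close>

lemma limit_point_lift: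
  assumes "seq_limit_point (Hol_topology X A) (\<lambda>n. L (Suc n)) g"
  obtains r :: "nat \<Rightarrow> nat" and G where "strict_mono r" "disc_map G" "\<And>z. cmod z < 1 \<Longrightarrow> p (G z) = g (p z)"
    "\<And>a. cmod a < 1 \<Longrightarrow> (\<lambda>n. \<mu> a (r n)) \<longlonglongrightarrow> disc_distortion G a"
proof -
  obtain r0 :: "nat \<Rightarrow> nat" where r0: "strict_mono r0"
    and lim: "limitin (Hol_topology X A) ((\<lambda>n. L (Suc n)) \<circ> r0) g sequentially"
    using assms by (auto simp: seq_limit_point_def)
  have pw: "(\<lambda>n. L (Suc (r0 n)) x) \<longlonglongrightarrow> g x" if "x \<in> X" for x
    using limitin_compact_open_pointwise[OF lim that] Hol_self_map by simp
  have "g \<in> Hol X A X A" using limitin_topspace[OF lim] by (simp add: topspace_compact_open)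
  then have "g (p 0) \<in> X" using Hol_self_map p_in[of 0] by fastforce
  then obtain c where c: "cmod c < 1" "p c = g (p 0)" using point_over by blast
  have "(\<lambda>n. L (Suc (r0 n)) (p 0)) \<longlonglongrightarrow> p c" using pw[of "p 0"] p_in[of 0] c(2) by simp
  then obtain r1 :: "nat \<Rightarrow> nat" and \<Phi> G where r1: "strict_mono r1" and \<Phi>: "\<And>n. disc_map (\<Phi> n)"
    "\<And>n z. cmod z < 1 \<Longrightarrow> p (\<Phi> n z) = L (Suc (r0 (r1 n))) (p z)" and G: "disc_map G"
    and ul: "\<And>K. \<lbrakk>compact K; K \<subseteq> unit_disc\<rbrakk> \<Longrightarrow> uniform_limit K \<Phi> G sequentially"
    using lifts_convergent_subsequence[of "\<lambda>n. L (Suc (r0 n))" 0 c] L_Suc_Hol c(1)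
    by (metis norm_zero zero_less_one)
  define r where "r n = Suc (r0 (r1 n))" for n
  have "strict_mono r" using r0 r1 by (auto simp: r_def strict_mono_def)
  moreover have "p (G z) = g (p z)" if z: "cmod z < 1" for z
  proof (rule LIMSEQ_unique)
    have "(\<lambda>n. \<Phi> n z) \<longlonglongrightarrow> G z"
      using ul[of "{z}"] z by (auto intro: tendsto_uniform_limitI)
    then show "(\<lambda>n. p (\<Phi> n z)) \<longlonglongrightarrow> p (G z)" using disc_map_in[OF G z] by (rule p_tendsto)
    show "(\<lambda>n. p (\<Phi> n z)) \<longlonglongrightarrow> g (p z)"
      using LIMSEQ_subseq_LIMSEQ[OF pw[OF p_in[OF z]] r1] \<Phi>(2)[OF z] by (simp add: o_def)
  qed
  moreover have "(\<lambda>n. \<mu> a (r n)) \<longlonglongrightarrow> disc_distortion G a" if a: "cmod a < 1" for a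
  proof -
    have "disc_distortion (\<Phi> n) a = \<mu> a (r n)" for n
      using hyp_distortion_eq_disc_distortion[OF \<Phi>(1), of n "L (r n)" a]
        hyp_distortion_eq_disc_distortion[OF \<Lambda>_lifts_L(1), of "r n" "L (r n)" a] \<Phi>(2) \<Lambda>_lifts_L(2) a
      unfolding r_def by metis
    then show ?thesis using tendsto_disc_distortion[OF \<Phi>(1) G ul a] by simp
  qed
  ultimately show thesis using that G by blast
qed

text \<open>
  Lifts of the orbit of \<open>p 0\<close> stay in a compact disc, so some subsequence of the orbit converges, and the
  corresponding maps have convergent lifts. Their limit \<open>G\<close> descends to the surface because
  \<open>p (G z)\<close> is the limit of \<open>L n (p z)\<close> and thus depends only on \<open>p z\<close>.
\<close>

lemma limit_point_exists: "\<exists>g. seq_limit_point (Hol_topology X A) (\<lambda>n. L (Suc n)) g"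
proof -
  obtain \<rho> where \<rho>: "\<rho> < 1" "\<And>n. L n (p 0) \<in> p ` ball 0 \<rho>"
    using orbit_bounded[of "p 0"] p_in[of 0] by (metis norm_zero zero_less_one)
  then have "\<exists>c. c \<in> cball 0 \<rho> \<and> p c = L (Suc n) (p 0)" for n
    by (metis ball_subset_cball imageE subsetD)
  then obtain c where c: "\<And>n. c n \<in> cball 0 \<rho>" "\<And>n. p (c n) = L (Suc n) (p 0)" by metis
  obtain c0 r0 where r0: "c0 \<in> cball 0 \<rho>" "strict_mono (r0 :: nat \<Rightarrow> nat)" "(c \<circ> r0) \<longlonglongrightarrow> c0"
    using compact_cball[of "0::complex" \<rho>] c(1) unfolding compact_def by metis
  have c0: "cmod c0 < 1" using r0(1) \<rho>(1) by simp
  have "(\<lambda>n. L (Suc (r0 n)) (p 0)) \<longlonglongrightarrow> p c0"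
    using p_tendsto[OF r0(3) c0] c(2) by simp
  then obtain r1 :: "nat \<Rightarrow> nat" and \<Phi> G where r1: "strict_mono r1" and \<Phi>: "\<And>n. disc_map (\<Phi> n)"
    "\<And>n z. cmod z < 1 \<Longrightarrow> p (\<Phi> n z) = L (Suc (r0 (r1 n))) (p z)" and G: "disc_map G"
    and ul: "\<And>K. \<lbrakk>compact K; K \<subseteq> unit_disc\<rbrakk> \<Longrightarrow> uniform_limit K \<Phi> G sequentially"
    using lifts_convergent_subsequence[of "\<lambda>n. L (Suc (r0 n))" 0 c0] L_Suc_Hol c0
    by (metis norm_zero zero_less_one)
  have lim: "(\<lambda>n. L (Suc (r0 (r1 n))) (p z)) \<longlonglongrightarrow> p (G z)" if z: "cmod z < 1" for z
  proof -
    have "(\<lambda>n. \<Phi> n z) \<longlonglongrightarrow> G z"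
      using ul[of "{z}"] z by (auto intro: tendsto_uniform_limitI)
    then have "(\<lambda>n. p (\<Phi> n z)) \<longlonglongrightarrow> p (G z)" using disc_map_in[OF G z] by (rule p_tendsto)
    then show ?thesis using \<Phi>(2)[OF z] by simp
  qed
  define g where "g = (\<lambda>x\<in>X. p (G (SOME z. cmod z < 1 \<and> p z = x)))"
  have gG: "g (p z) = p (G z)" if z: "cmod z < 1" for z
  proof -
    define z' where "z' = (SOME z'. cmod z' < 1 \<and> p z' = p z)"
    have "\<exists>z'. cmod z' < 1 \<and> p z' = p z" using z by blast
    then have "cmod z' < 1 \<and> p z' = p z" unfolding z'_def by (rule someI_ex)
    then have "p (G z') = p (G z)" using lim[of z'] lim[OF z] LIMSEQ_unique by metis
    then show ?thesis using p_in[OF z] by (simp add: g_def z'_def)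
  qed
  have hm: "holomorphic_map X A X A g" using G gG by (rule holomorphic_map_descend)
  then have "g \<in> X \<rightarrow>\<^sub>E X" by (auto simp: holomorphic_map_def g_def PiE_def)
  then have gH: "g \<in> Hol X A X A" using hm by (simp add: Hol_def)
  have "limitin (Hol_topology X A) (\<lambda>n. L (Suc (r0 (r1 n)))) g sequentially"
    using L_Suc_Hol gH \<Phi> G gG ul by (rule limitin_Hol_of_lifts)
  moreover have "strict_mono (r0 \<circ> r1)" using r0(2) r1 by (rule strict_mono_o)
  ultimately show ?thesis
    unfolding seq_limit_point_def by (intro exI[of _ g] exI[of _ "r0 \<circ> r1"]) (auto simp: o_def)
qed

text \<open>
  The decreasing sequence \<open>\<mu> a\<close> has a subsequence with the positive limit \<open>disc_distortion G a\<close>, where \<open>a\<close>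
  is any point with \<open>G' a \<noteq> 0\<close>.
\<close>

lemma summable_of_nonconstant_limit_point:
  assumes g: "seq_limit_point (Hol_topology X A) (\<lambda>n. L (Suc n)) g" "\<not> g constant_on X" and x: "x \<in> X"
  shows "summable (\<lambda>n. 1 - \<delta> n x)"
proof -
  obtain r G where r: "strict_mono r" and G: "disc_map G" "\<And>z. cmod z < 1 \<Longrightarrow> p (G z) = g (p z)"
    and lim: "\<And>a. cmod a < 1 \<Longrightarrow> (\<lambda>n. \<mu> a (r n)) \<longlonglongrightarrow> disc_distortion G a"
    using limit_point_lift[OF g(1)] by metis
  have "\<exists>a. cmod a < 1 \<and> deriv G a \<noteq> 0"
  proof (rule ccontr)
    assume "\<not> ?thesis"
    then have "\<exists>k. \<forall>z\<in>unit_disc. G z = k"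
      using disc_map_deriv[OF G(1)]
      by (intro has_field_derivative_zero_constant[of unit_disc G])
        (auto intro: has_field_derivative_at_within)
    then obtain k where "\<And>z. cmod z < 1 \<Longrightarrow> G z = k" by auto
    then have "g y = p k" if "y \<in> X" for y using point_over[OF that] G(2) by metis
    then show False using g(2) by (auto simp: constant_on_def)
  qed
  then obtain a where a: "cmod a < 1" "deriv G a \<noteq> 0" by blast
  have \<mu>0: "0 \<le> \<mu> a n" for n using \<Lambda>_lifts_L(1) a(1) by (rule disc_distortion_nonneg)
  have La: "L n (p a) \<in> X" for n using L_in[OF p_in[OF a(1)]] .
  have "decseq (\<mu> a)" unfolding decseq_Suc_iff
    using composite_distortion(2)[OF a(1)] \<mu>0 distortion_le_1[OF La] distortion_nonneg[OF La]
    by (simp add: mult_left_le_one_le)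
  then obtain l where l: "\<mu> a \<longlonglongrightarrow> l" using decseq_convergent[of "\<mu> a" 0] \<mu>0 by blast
  then have "(\<lambda>n. \<mu> a (r n)) \<longlonglongrightarrow> l" using LIMSEQ_subseq_LIMSEQ[OF l r] by (simp add: o_def)
  then have "l = disc_distortion G a" using lim[OF a(1)] LIMSEQ_unique by blast
  moreover have "disc_distortion G a \<noteq> 0" using disc_distortion_eq_0_iff[OF G(1) a(1)] a(2) by simp
  moreover have "0 \<le> disc_distortion G a" using G(1) a(1) by (rule disc_distortion_nonneg)
  ultimately have "l > 0" by simp
  then have "summable (\<lambda>n. 1 - \<delta> n (L n (p a)))"
    using composite_distortion[OF a(1)] distortion_nonneg[OF La] distortion_le_1[OF La] l
    by (intro summable_of_product_limit_pos[of "\<mu> a"])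
  then show ?thesis using summable_along_orbit_iff[OF x p_in[OF a(1)]] by simp
qed

text \<open>
  The maps \<open>f n\<close> are nonconstant, hence so are all composites, and each of them has only countably
  many critical points. At any other point \<open>a\<close> all factors of the product are positive.
\<close>

lemma limit_points_nonconstant_of_summable:
  assumes nonconst: "\<And>n. n \<ge> 1 \<Longrightarrow> \<not> f n constant_on X"
    and x: "x \<in> X" and sum: "summable (\<lambda>n. 1 - \<delta> n x)"
    and g: "seq_limit_point (Hol_topology X A) (\<lambda>n. L (Suc n)) g"
  shows "\<not> g constant_on X"
proof -
  have F_nonconst: "\<not> F n constant_on unit_disc" if n: "n \<ge> 1" for n
  proof
    assume "F n constant_on unit_disc"
    then obtain k where "\<And>z. cmod z < 1 \<Longrightarrow> F n z = k" by (auto simp: constant_on_def)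
    then have "f n y = p k" if "y \<in> X" for y using point_over[OF that] F_lifts_f(2)[OF n] by metis
    then show False using nonconst[OF n] by (auto simp: constant_on_def)
  qed
  have \<Lambda>_nonconst: "\<not> \<Lambda> n constant_on unit_disc" for n
  proof (induction n)
    case 0
    have "\<Lambda> 0 0 \<noteq> \<Lambda> 0 (1/2)" by simp
    moreover have "0 \<in> unit_disc" "1/2 \<in> unit_disc" by (auto simp: norm_divide)
    ultimately show ?case unfolding constant_on_def by metis
  next
    case (Suc n)
    have "1 \<le> Suc n" by simp
    then show ?case
      unfolding \<Lambda>.simps using disc_map_nonconstant_compose[OF \<Lambda>_lifts_L(1) Suc F_lifts_f(1) F_nonconst] by blast
  qed
  have "countable (\<Union>n. {z \<in> unit_disc. deriv (\<Lambda> n) z = 0})"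
    using countable_critical_points[OF \<Lambda>_lifts_L(1) \<Lambda>_nonconst] by blast
  moreover have "uncountable unit_disc" by (rule uncountable_ball) simp
  ultimately have "\<not> unit_disc \<subseteq> (\<Union>n. {z \<in> unit_disc. deriv (\<Lambda> n) z = 0})"
    using countable_subset by blast
  then have "\<exists>a. cmod a < 1 \<and> (\<forall>n. deriv (\<Lambda> n) a \<noteq> 0)" by auto
  then obtain a where a: "cmod a < 1" "\<And>n. deriv (\<Lambda> n) a \<noteq> 0" by blast
  have La: "L n (p a) \<in> X" for n using L_in[OF p_in[OF a(1)]] .
  have \<delta>_pos: "0 < \<delta> n (L n (p a))" for n
  proof -
    have "\<mu> a (Suc n) \<noteq> 0" using disc_distortion_eq_0_iff[OF \<Lambda>_lifts_L(1) a(1)] a(2) by blast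
    then have "\<delta> n (L n (p a)) \<noteq> 0" using composite_distortion(2)[OF a(1), of n] by auto
    then show ?thesis using distortion_nonneg[OF La, of n n] by simp
  qed
  have "summable (\<lambda>n. 1 - \<delta> n (L n (p a)))"
    using sum summable_along_orbit_iff[OF x p_in[OF a(1)]] by simp
  then obtain l where l: "\<mu> a \<longlonglongrightarrow> l" "l > 0"
    using product_limit_pos_of_summable[of "\<mu> a" "\<lambda>n. \<delta> n (L n (p a))"]
      composite_distortion[OF a(1)] \<delta>_pos distortion_le_1[OF La] by metis
  obtain r G where r: "strict_mono r" and G: "disc_map G" "\<And>z. cmod z < 1 \<Longrightarrow> p (G z) = g (p z)"
    and lim: "(\<lambda>n. \<mu> a (r n)) \<longlonglongrightarrow> disc_distortion G a"
    using limit_point_lift[OF g] a(1) by metis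
  have "(\<lambda>n. \<mu> a (r n)) \<longlonglongrightarrow> l" using LIMSEQ_subseq_LIMSEQ[OF l(1) r] by (simp add: o_def)
  then have "disc_distortion G a = l" using lim LIMSEQ_unique by blast
  then show ?thesis using nonconstant_of_distortion_pos[OF G a(1)] l(2) by simp
qed

end

theorem theoremE:
  fixes X :: "'a::t2_space set" and A :: "'a chart set"
    and f L :: "nat \<Rightarrow> 'a \<Rightarrow> 'a"
  assumes "hyperbolic_surface X A"
    and "\<And>n. n \<ge> 1 \<Longrightarrow> f n \<in> Hol X A X A"
    and "\<And>n. n \<ge> 1 \<Longrightarrow> \<not> f n constant_on X"
    and "\<And>n. L n = left_comp X f n"
    and "relatively_compactin (Hol_topology X A) {L n | n. n \<ge> 1}"
  shows "((\<forall>g. seq_limit_point (Hol_topology X A) (\<lambda>n. L (Suc n)) g \<longrightarrow> \<not> g constant_on X) \<longleftrightarrow>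
          (\<exists>g. seq_limit_point (Hol_topology X A) (\<lambda>n. L (Suc n)) g \<and> \<not> g constant_on X)) \<and>
         ((\<exists>g. seq_limit_point (Hol_topology X A) (\<lambda>n. L (Suc n)) g \<and> \<not> g constant_on X) \<longleftrightarrow>
          (\<exists>z\<in>X. summable (\<lambda>n. 1 - hyp_distortion X A (f (Suc n)) z))) \<and>
         ((\<exists>z\<in>X. summable (\<lambda>n. 1 - hyp_distortion X A (f (Suc n)) z)) \<longleftrightarrow>
          (\<forall>z\<in>X. summable (\<lambda>n. 1 - hyp_distortion X A (f (Suc n)) z)))"
proof -
  define p where "p = (SOME p. disc_covering X A p)"
  have "\<exists>p. disc_covering X A p" using assms(1) by (simp add: hyperbolic_surface_def)
  then have "disc_covering X A p" unfolding p_def by (rule someI_ex)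
  then interpret left_iteration X A p f L
    using assms by unfold_locales (auto simp: p_def hyperbolic_surface_def)
  obtain x where x: "x \<in> X"
    using assms(1) by (auto simp: hyperbolic_surface_def riemann_surface_def)
  let ?lim = "seq_limit_point (Hol_topology X A) (\<lambda>n. L (Suc n))"
  let ?sum = "\<lambda>z. summable (\<lambda>n. 1 - hyp_distortion X A (f (Suc n)) z)"
  have "(\<forall>g. ?lim g \<longrightarrow> \<not> g constant_on X) \<Longrightarrow> (\<exists>g. ?lim g \<and> \<not> g constant_on X)"
    using limit_point_exists by blast
  moreover have "(\<exists>g. ?lim g \<and> \<not> g constant_on X) \<Longrightarrow> (\<forall>z\<in>X. ?sum z)"
    using summable_of_nonconstant_limit_point by blast
  moreover have "(\<forall>z\<in>X. ?sum z) \<Longrightarrow> (\<exists>z\<in>X. ?sum z)" using x by (intro bexI[of _ x]) auto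
  moreover have "(\<exists>z\<in>X. ?sum z) \<Longrightarrow> (\<forall>g. ?lim g \<longrightarrow> \<not> g constant_on X)"
    using limit_points_nonconstant_of_summable[OF assms(3)] by blast
  ultimately show ?thesis by argo
qed

end
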